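(* Let $(M,\varphi,\xi,\eta,g)$ be a 3-dimensional Sasaki-like almost contact B-metric manifold with associated metric $\widetilde g$, and let $(C(t),\overline{\mathbf F})$ be a Legendre null curve with respect to $g$ in $M$ of constant curvatures $\bar k_1$ and $\bar k_2$. Put $b=g(\dot C,\varphi\dot C)$. Then the curve $C$ with respect to $\widetilde g$ (parameterized by its $\widetilde g$-arc length) is (i) spacelike if $b>0$, or timelike if $b<0$; (ii) a Legendre curve; (iii) a geodesic.
   Context: A 3-dimensional almost contact B-metric manifold $(M,\varphi,\xi,\eta,g)$ is a smooth 3-manifold with an endomorphism $\varphi$ of $TM$, a vector field $\xi$, a 1-form $\eta$ and a pseudo-Riemannian metric $g$ (necessarily of signature $(+,+,-)$) such that $\varphi^2X=-X+\eta(X)\xi$, $\eta(\xi)=1$, $g(\varphi X,\varphi Y)=-g(X,Y)+\eta(X)\eta(Y)$. Consequences: $\eta\circ\varphi=0$, $\varphi\xi=0$, $\eta(X)=g(X,\xi)$. With $\nabla$ the Levi-Civita connection of $g$, it is Sasaki-like if $(\nabla_X\varphi)Y=-g(X,Y)\xi-\eta(Y)X+2\eta(X)\eta(Y)\xi$ (then $\nabla_X\xi=-\varphi X$). The associated metric is $\widetilde g(X,Y)=g(X,\varphi Y)+\eta(X)\eta(Y)$, again a B-metric of signature $(+,+,-)$, with Levi-Civita connection $\widetilde\nabla$. On a 3-dimensional Sasaki-like manifold it is known that $\widetilde\nabla_XY-\nabla_XY=-\{g(X,\varphi Y)-g(\varphi X,\varphi Y)\}\xi$. A smooth curve $C:I\to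 M$ ($I$ an interval) is null with respect to $g$ if $g(\dot C,\dot C)=0$ and $\dot C\neq 0$ on $I$. It is Legendre with respect to $g$ if $g(\dot C,\xi)=\eta(\dot C)=0$, and Legendre with respect to $\widetilde g$ if $\widetilde g(C',\xi)=0$. For a Legendre null curve with respect to $g$, $b$ is nowhere zero. A unit speed curve with velocity $C'$ is spacelike (resp. timelike) with respect to $\widetilde g$ if $\widetilde g(C',C')=1$ (resp. $-1$), and a geodesic with respect to $\widetilde g$ if $\widetilde\nabla_{C'}C'=0$. For a Legendre null curve with respect to $g$, $\overline{\mathbf F}=\{\dot C,\overline N,\overline W\}$ is the frame with $\overline W=\epsilon_1\epsilon\left(\xi+\frac{\dot b}{2b^2}\dot C\right)$, $\epsilon,\epsilon_1\in\{1,-1\}$, and $\overline N$ the unique field with $g(\dot C,\overline N)=1$, $g(\overline N,\overline N)=g(\overline N,\overline W)=0$. Then $\nabla_{\dot C}\dot C=\bar k_1\overline W$, $\nabla_{\dot C}\overline N=\bar k_2\overline W$, $\nabla_{\dot C}\overline W=-\bar k_2\dot C-\bar k_1\overline N$, which defines the curvatures $\bar k_1,\bar k_2$. *)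

theory Defs
  imports "HOL-Analysis.Analysis" "HOL-Library.Function_Algebras"
begin

text \<open>Pointwise scalar multiplication; addition on functions is that of
  \<^theory>\<open>HOL-Library.Function_Algebras\<close>.\<close>

instantiation "fun" :: (type, scaleR) scaleR
begin
definition "r *\<^sub>R f = (\<lambda>x. r *\<^sub>R f x)"
instance ..
end

instance "fun" :: (type, real_vector) real_vector
  by standard (auto simp: scaleR_fun_def fun_eq_iff scaleR_add_right scaleR_add_left)


section \<open>Smooth maps\<close>

text \<open>Derivatives are taken within the set. The definition is used for open subsets of
  \<^typ>\<open>real^3\<close> and for relatively open subsets of nondegenerate intervals (one-sided
  derivatives at end points), where derivatives within the set are unique.\<close>

primrec Ck_on :: "nat \<Rightarrow> ('a::real_normed_vector \<Rightarrow> 'b::real_normed_vector) \<Rightarrow> 'a set \<Rightarrow> bool" where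
  "Ck_on 0 f S \<longleftrightarrow> continuous_on S f"
| "Ck_on (Suc k) f S \<longleftrightarrow>
     (\<forall>x\<in>S. f differentiable (at x within S)) \<and>
     (\<forall>v. Ck_on k (\<lambda>x. frechet_derivative f (at x within S) v) S)"

definition smooth_on :: "('a::real_normed_vector \<Rightarrow> 'b::real_normed_vector) \<Rightarrow> 'a set \<Rightarrow> bool" where
  "smooth_on f S \<longleftrightarrow> (\<forall>k. Ck_on k f S)"


section \<open>Smooth 3-manifolds\<close>

text \<open>A chart is a pair of its domain and its coordinate map.\<close>

type_synonym 'a chart = "'a set \<times> ('a \<Rightarrow> real^3)"

abbreviation cinv :: "'a chart \<Rightarrow> real^3 \<Rightarrow> 'a" where
  "cinv c \<equiv> inv_into (fst c) (snd c)"

definition is_chart :: "'a::topological_space chart \<Rightarrow> bool" where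
  "is_chart c \<longleftrightarrow> open (fst c) \<and> open (snd c ` fst c) \<and>
     homeomorphism (fst c) (snd c ` fst c) (snd c) (cinv c)"

definition transition :: "'a chart \<Rightarrow> 'a chart \<Rightarrow> real^3 \<Rightarrow> real^3" where
  "transition c c' x = snd c' (cinv c x)"

text \<open>The manifold is the union of the chart domains, an open subspace of the ambient type.
  It need not be connected, and the atlas need not be maximal.\<close>

definition smooth_atlas :: "'a::{t2_space,second_countable_topology} chart set \<Rightarrow> bool" where
  "smooth_atlas A \<longleftrightarrow> (\<forall>c\<in>A. is_chart c) \<and>
     (\<forall>c\<in>A. \<forall>c'\<in>A. smooth_on (transition c c') (snd c ` (fst c \<inter> fst c')))"

definition manifold_carrier :: "'a chart set \<Rightarrow> 'a set" where
  "manifold_carrier A = (\<Union>c\<in>A. fst c)"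

definition charts_at :: "'a chart set \<Rightarrow> 'a \<Rightarrow> 'a chart set" where
  "charts_at A p = {c\<in>A. p \<in> fst c}"


section \<open>Tangent vectors and tensor fields\<close>

text \<open>A tangent vector at \<open>p\<close> is the family of its component vectors in the charts around \<open>p\<close>,
  related by the Jacobians of the transition maps (and \<open>0\<close> at all other charts).\<close>

type_synonym 'a tangent = "'a chart \<Rightarrow> real^3"

definition transition_deriv :: "'a chart \<Rightarrow> 'a chart \<Rightarrow> 'a \<Rightarrow> real^3 \<Rightarrow> real^3" where
  "transition_deriv c c' p v = frechet_derivative (transition c c') (at (snd c p)) v"

definition tangent_space :: "'a chart set \<Rightarrow> 'a \<Rightarrow> 'a tangent set" where
  "tangent_space A p = {v.
     (\<forall>c. c \<notin> charts_at A p \<longrightarrow> v c = 0) \<and>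
     (\<forall>c\<in>charts_at A p. \<forall>c'\<in>charts_at A p. v c' = transition_deriv c c' p (v c))}"

text \<open>The tangent vector at \<open>p\<close> with components \<open>x\<close> in the chart \<open>c\<close>.\<close>

definition coord_vector :: "'a chart set \<Rightarrow> 'a chart \<Rightarrow> 'a \<Rightarrow> real^3 \<Rightarrow> 'a tangent" where
  "coord_vector A c p x = (\<lambda>c'. if c' \<in> charts_at A p then transition_deriv c c' p x else 0)"

definition vector_field_on_chart :: "'a chart set \<Rightarrow> 'a chart \<Rightarrow> ('a \<Rightarrow> 'a tangent) \<Rightarrow> bool" where
  "vector_field_on_chart A c X \<longleftrightarrow> (\<forall>p\<in>fst c. X p \<in> tangent_space A p) \<and>
     smooth_on (\<lambda>x. X (cinv c x) c) (snd c ` fst c)"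

definition vector_field :: "'a chart set \<Rightarrow> ('a \<Rightarrow> 'a tangent) \<Rightarrow> bool" where
  "vector_field A X \<longleftrightarrow> (\<forall>c\<in>A. vector_field_on_chart A c X)"

definition linear_on :: "'v::real_vector set \<Rightarrow> ('v \<Rightarrow> 'w::real_vector) \<Rightarrow> bool" where
  "linear_on T f \<longleftrightarrow> (\<forall>u\<in>T. \<forall>v\<in>T. \<forall>a b. f (a *\<^sub>R u + b *\<^sub>R v) = a *\<^sub>R f u + b *\<^sub>R f v)"

definition one_form :: "'a chart set \<Rightarrow> ('a \<Rightarrow> 'a tangent \<Rightarrow> real) \<Rightarrow> bool" where
  "one_form A \<eta> \<longleftrightarrow> (\<forall>p\<in>manifold_carrier A. linear_on (tangent_space A p) (\<eta> p)) \<and>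
     (\<forall>c\<in>A. \<forall>v. smooth_on (\<lambda>x. \<eta> (cinv c x) (coord_vector A c (cinv c x) v)) (snd c ` fst c))"

definition endomorphism_field :: "'a chart set \<Rightarrow> ('a \<Rightarrow> 'a tangent \<Rightarrow> 'a tangent) \<Rightarrow> bool" where
  "endomorphism_field A \<phi> \<longleftrightarrow>
     (\<forall>p\<in>manifold_carrier A. linear_on (tangent_space A p) (\<phi> p) \<and>
        \<phi> p ` tangent_space A p \<subseteq> tangent_space A p) \<and>
     (\<forall>c\<in>A. \<forall>v. smooth_on (\<lambda>x. \<phi> (cinv c x) (coord_vector A c (cinv c x) v) c) (snd c ` fst c))"

definition pseudo_riemannian_metric ::
    "'a chart set \<Rightarrow> ('a \<Rightarrow> 'a tangent \<Rightarrow> 'a tangent \<Rightarrow> real) \<Rightarrow> bool" where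
  "pseudo_riemannian_metric A g \<longleftrightarrow>
     (\<forall>p\<in>manifold_carrier A. let T = tangent_space A p in
        (\<forall>u\<in>T. linear_on T (g p u)) \<and>
        (\<forall>u\<in>T. \<forall>v\<in>T. g p u v = g p v u) \<and>
        (\<forall>u\<in>T. (\<forall>v\<in>T. g p u v = 0) \<longrightarrow> u = 0)) \<and>
     (\<forall>c\<in>A. \<forall>v w. smooth_on (\<lambda>x. g (cinv c x) (coord_vector A c (cinv c x) v)
        (coord_vector A c (cinv c x) w)) (snd c ` fst c))"


section \<open>Connections\<close>

text \<open>An affine connection is given by its connection coefficients: \<open>\<Gamma> c p v w\<close> is
  \<open>\<Gamma>\<^sup>k\<^sub>i\<^sub>j v\<^sup>i w\<^sup>j\<close> in the chart \<open>c\<close> at \<open>p\<close>, i.e. the components of the derivative in the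
  direction \<open>v\<close> of the field with constant components \<open>w\<close>. The last conjunct is the usual
  inhomogeneous transformation law, which makes \<open>nabla\<close> below independent of charts.\<close>

type_synonym 'a conn = "'a chart \<Rightarrow> 'a \<Rightarrow> real^3 \<Rightarrow> real^3 \<Rightarrow> real^3"

definition connection :: "'a chart set \<Rightarrow> 'a conn \<Rightarrow> bool" where
  "connection A \<Gamma> \<longleftrightarrow>
     (\<forall>c\<in>A. \<forall>p\<in>fst c. bilinear (\<Gamma> c p)) \<and>
     (\<forall>c\<in>A. \<forall>v w. smooth_on (\<lambda>x. \<Gamma> c (cinv c x) v w) (snd c ` fst c)) \<and>
     (\<forall>p\<in>manifold_carrier A. \<forall>c\<in>charts_at A p. \<forall>c'\<in>charts_at A p. \<forall>v w.
        transition_deriv c c' p (\<Gamma> c p v w) =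
          \<Gamma> c' p (transition_deriv c c' p v) (transition_deriv c c' p w) +
          frechet_derivative (\<lambda>x. frechet_derivative (transition c c') (at x) w) (at (snd c p)) v)"

definition nabla ::
    "'a chart set \<Rightarrow> 'a conn \<Rightarrow> ('a \<Rightarrow> 'a tangent) \<Rightarrow> ('a \<Rightarrow> 'a tangent) \<Rightarrow> 'a \<Rightarrow> 'a tangent" where
  "nabla A \<Gamma> X Y p = (\<lambda>c. if c \<in> charts_at A p
     then frechet_derivative (\<lambda>x. Y (cinv c x) c) (at (snd c p)) (X p c) + \<Gamma> c p (X p c) (Y p c)
     else 0)"

definition lie_bracket ::
    "'a chart set \<Rightarrow> ('a \<Rightarrow> 'a tangent) \<Rightarrow> ('a \<Rightarrow> 'a tangent) \<Rightarrow> 'a \<Rightarrow> 'a tangent" where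
  "lie_bracket A X Y p = (\<lambda>c. if c \<in> charts_at A p
     then frechet_derivative (\<lambda>x. Y (cinv c x) c) (at (snd c p)) (X p c)
        - frechet_derivative (\<lambda>x. X (cinv c x) c) (at (snd c p)) (Y p c)
     else 0)"

text \<open>The derivative of the function \<open>f\<close> at \<open>p\<close> along \<open>v\<close>, computed in a chart \<open>c\<close> around \<open>p\<close>.\<close>

definition dir_deriv :: "'a chart \<Rightarrow> ('a \<Rightarrow> real) \<Rightarrow> 'a \<Rightarrow> 'a tangent \<Rightarrow> real" where
  "dir_deriv c f p v = frechet_derivative (\<lambda>x. f (cinv c x)) (at (snd c p)) (v c)"

text \<open>The torsion-free metric connection. Everything here is local, so it is enough (and
  saves bump functions) to let the vector fields range over those defined on chart domains.\<close>

definition levi_civita ::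
    "'a chart set \<Rightarrow> ('a \<Rightarrow> 'a tangent \<Rightarrow> 'a tangent \<Rightarrow> real) \<Rightarrow> 'a conn \<Rightarrow> bool" where
  "levi_civita A g \<Gamma> \<longleftrightarrow> connection A \<Gamma> \<and>
     (\<forall>c\<in>A. \<forall>X Y. vector_field_on_chart A c X \<longrightarrow> vector_field_on_chart A c Y \<longrightarrow>
        (\<forall>p\<in>fst c. nabla A \<Gamma> X Y p - nabla A \<Gamma> Y X p = lie_bracket A X Y p)) \<and>
     (\<forall>c\<in>A. \<forall>X Y Z. vector_field_on_chart A c X \<longrightarrow> vector_field_on_chart A c Y \<longrightarrow>
        vector_field_on_chart A c Z \<longrightarrow>
        (\<forall>p\<in>fst c. dir_deriv c (\<lambda>q. g q (Y q) (Z q)) p (X p) =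
           g p (nabla A \<Gamma> X Y p) (Z p) + g p (Y p) (nabla A \<Gamma> X Z p)))"


section \<open>Sasaki-like almost contact B-metric manifolds\<close>

definition almost_contact_B_metric ::
    "'a::{t2_space,second_countable_topology} chart set \<Rightarrow> ('a \<Rightarrow> 'a tangent \<Rightarrow> 'a tangent) \<Rightarrow>
     ('a \<Rightarrow> 'a tangent) \<Rightarrow> ('a \<Rightarrow> 'a tangent \<Rightarrow> real) \<Rightarrow>
     ('a \<Rightarrow> 'a tangent \<Rightarrow> 'a tangent \<Rightarrow> real) \<Rightarrow> bool" where
  "almost_contact_B_metric A \<phi> \<xi> \<eta> g \<longleftrightarrow>
     smooth_atlas A \<and> endomorphism_field A \<phi> \<and> vector_field A \<xi> \<and> one_form A \<eta> \<and>
     pseudo_riemannian_metric A g \<and>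
     (\<forall>p\<in>manifold_carrier A. \<eta> p (\<xi> p) = 1 \<and>
        (\<forall>u\<in>tangent_space A p. \<phi> p (\<phi> p u) = - u + \<eta> p u *\<^sub>R \<xi> p) \<and>
        (\<forall>u\<in>tangent_space A p. \<forall>v\<in>tangent_space A p.
           g p (\<phi> p u) (\<phi> p v) = - g p u v + \<eta> p u * \<eta> p v))"

definition nabla_endo ::
    "'a chart set \<Rightarrow> 'a conn \<Rightarrow> ('a \<Rightarrow> 'a tangent \<Rightarrow> 'a tangent) \<Rightarrow>
     ('a \<Rightarrow> 'a tangent) \<Rightarrow> ('a \<Rightarrow> 'a tangent) \<Rightarrow> 'a \<Rightarrow> 'a tangent" where
  "nabla_endo A \<Gamma> \<phi> X Y p = nabla A \<Gamma> X (\<lambda>q. \<phi> q (Y q)) p - \<phi> p (nabla A \<Gamma> X Y p)"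

definition sasaki_like ::
    "'a::{t2_space,second_countable_topology} chart set \<Rightarrow> ('a \<Rightarrow> 'a tangent \<Rightarrow> 'a tangent) \<Rightarrow>
     ('a \<Rightarrow> 'a tangent) \<Rightarrow> ('a \<Rightarrow> 'a tangent \<Rightarrow> real) \<Rightarrow>
     ('a \<Rightarrow> 'a tangent \<Rightarrow> 'a tangent \<Rightarrow> real) \<Rightarrow> 'a conn \<Rightarrow> bool" where
  "sasaki_like A \<phi> \<xi> \<eta> g \<Gamma> \<longleftrightarrow>
     almost_contact_B_metric A \<phi> \<xi> \<eta> g \<and> levi_civita A g \<Gamma> \<and>
     (\<forall>c\<in>A. \<forall>X Y. vector_field_on_chart A c X \<longrightarrow> vector_field_on_chart A c Y \<longrightarrow>
        (\<forall>p\<in>fst c. nabla_endo A \<Gamma> \<phi> X Y p =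
           - (g p (X p) (Y p) *\<^sub>R \<xi> p) - \<eta> p (Y p) *\<^sub>R X p
           + (2 * \<eta> p (X p) * \<eta> p (Y p)) *\<^sub>R \<xi> p))"

definition associated_metric ::
    "('a \<Rightarrow> 'a tangent \<Rightarrow> 'a tangent) \<Rightarrow> ('a \<Rightarrow> 'a tangent \<Rightarrow> real) \<Rightarrow>
     ('a \<Rightarrow> 'a tangent \<Rightarrow> 'a tangent \<Rightarrow> real) \<Rightarrow> 'a \<Rightarrow> 'a tangent \<Rightarrow> 'a tangent \<Rightarrow> real" where
  "associated_metric \<phi> \<eta> g p u v = g p u (\<phi> p v) + \<eta> p u * \<eta> p v"


section \<open>Curves\<close>

definition smooth_curve ::
    "'a::topological_space chart set \<Rightarrow> real set \<Rightarrow> (real \<Rightarrow> 'a) \<Rightarrow> bool" where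
  "smooth_curve A I C \<longleftrightarrow>
     is_interval I \<and> (\<exists>s\<in>I. \<exists>t\<in>I. s < t) \<and>
     C ` I \<subseteq> manifold_carrier A \<and> continuous_on I C \<and>
     (\<forall>c\<in>A. smooth_on (\<lambda>t. snd c (C t)) {t\<in>I. C t \<in> fst c})"

definition velocity :: "'a chart set \<Rightarrow> real set \<Rightarrow> (real \<Rightarrow> 'a) \<Rightarrow> real \<Rightarrow> 'a tangent" where
  "velocity A I C t = (\<lambda>c. if c \<in> charts_at A (C t)
     then vector_derivative (\<lambda>s. snd c (C s)) (at t within I) else 0)"

definition nabla_along ::
    "'a chart set \<Rightarrow> 'a conn \<Rightarrow> real set \<Rightarrow> (real \<Rightarrow> 'a) \<Rightarrow> (real \<Rightarrow> 'a tangent) \<Rightarrow>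
     real \<Rightarrow> 'a tangent" where
  "nabla_along A \<Gamma> I C V t = (\<lambda>c. if c \<in> charts_at A (C t)
     then vector_derivative (\<lambda>s. V s c) (at t within I) + \<Gamma> c (C t) (velocity A I C t c) (V t c)
     else 0)"

definition null_curve ::
    "'a chart set \<Rightarrow> ('a \<Rightarrow> 'a tangent \<Rightarrow> 'a tangent \<Rightarrow> real) \<Rightarrow> real set \<Rightarrow> (real \<Rightarrow> 'a) \<Rightarrow> bool" where
  "null_curve A g I C \<longleftrightarrow>
     (\<forall>t\<in>I. g (C t) (velocity A I C t) (velocity A I C t) = 0 \<and> velocity A I C t \<noteq> 0)"

text \<open>For the B-metric \<open>g\<close> itself, \<open>g(X,\<xi>) = \<eta>(X)\<close>, so this is also \<open>\<eta>(X) = 0\<close> for the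
  velocity \<open>X\<close>.\<close>

definition legendre_curve ::
    "'a chart set \<Rightarrow> ('a \<Rightarrow> 'a tangent) \<Rightarrow> ('a \<Rightarrow> 'a tangent \<Rightarrow> 'a tangent \<Rightarrow> real) \<Rightarrow>
     real set \<Rightarrow> (real \<Rightarrow> 'a) \<Rightarrow> bool" where
  "legendre_curve A \<xi> g I C \<longleftrightarrow> (\<forall>t\<in>I. g (C t) (velocity A I C t) (\<xi> (C t)) = 0)"

definition unit_spacelike_curve ::
    "'a chart set \<Rightarrow> ('a \<Rightarrow> 'a tangent \<Rightarrow> 'a tangent \<Rightarrow> real) \<Rightarrow> real set \<Rightarrow> (real \<Rightarrow> 'a) \<Rightarrow> bool" where
  "unit_spacelike_curve A g I C \<longleftrightarrow> (\<forall>t\<in>I. g (C t) (velocity A I C t) (velocity A I C t) = 1)"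

definition unit_timelike_curve ::
    "'a chart set \<Rightarrow> ('a \<Rightarrow> 'a tangent \<Rightarrow> 'a tangent \<Rightarrow> real) \<Rightarrow> real set \<Rightarrow> (real \<Rightarrow> 'a) \<Rightarrow> bool" where
  "unit_timelike_curve A g I C \<longleftrightarrow> (\<forall>t\<in>I. g (C t) (velocity A I C t) (velocity A I C t) = -1)"

definition geodesic_curve ::
    "'a chart set \<Rightarrow> 'a conn \<Rightarrow> real set \<Rightarrow> (real \<Rightarrow> 'a) \<Rightarrow> bool" where
  "geodesic_curve A \<Gamma> I C \<longleftrightarrow> (\<forall>t\<in>I. nabla_along A \<Gamma> I C (velocity A I C) t = 0)"

text \<open>Arc length from the parameter value \<open>t0\<close>, negative to the left of \<open>t0\<close>.\<close>

definition arc_length ::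
    "'a chart set \<Rightarrow> ('a \<Rightarrow> 'a tangent \<Rightarrow> 'a tangent \<Rightarrow> real) \<Rightarrow> real set \<Rightarrow> (real \<Rightarrow> 'a) \<Rightarrow>
     real \<Rightarrow> real \<Rightarrow> real" where
  "arc_length A g I C t0 t =
     (let v = (\<lambda>u. sqrt \<bar>g (C u) (velocity A I C u) (velocity A I C u)\<bar>)
      in if t0 \<le> t then integral {t0..t} v else - integral {t..t0} v)"

definition arc_length_param ::
    "'a chart set \<Rightarrow> ('a \<Rightarrow> 'a tangent \<Rightarrow> 'a tangent \<Rightarrow> real) \<Rightarrow> real set \<Rightarrow> (real \<Rightarrow> 'a) \<Rightarrow>
     real \<Rightarrow> real \<Rightarrow> 'a" where
  "arc_length_param A g I C t0 = C \<circ> inv_into I (arc_length A g I C t0)"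


section \<open>The frame of a Legendre null curve\<close>

definition curve_b ::
    "'a chart set \<Rightarrow> ('a \<Rightarrow> 'a tangent \<Rightarrow> 'a tangent) \<Rightarrow>
     ('a \<Rightarrow> 'a tangent \<Rightarrow> 'a tangent \<Rightarrow> real) \<Rightarrow> real set \<Rightarrow> (real \<Rightarrow> 'a) \<Rightarrow> real \<Rightarrow> real" where
  "curve_b A \<phi> g I C t = g (C t) (velocity A I C t) (\<phi> (C t) (velocity A I C t))"

definition frame_W ::
    "'a chart set \<Rightarrow> ('a \<Rightarrow> 'a tangent \<Rightarrow> 'a tangent) \<Rightarrow> ('a \<Rightarrow> 'a tangent) \<Rightarrow>
     ('a \<Rightarrow> 'a tangent \<Rightarrow> 'a tangent \<Rightarrow> real) \<Rightarrow> real \<Rightarrow> real \<Rightarrow> real set \<Rightarrow> (real \<Rightarrow> 'a) \<Rightarrow>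
     real \<Rightarrow> 'a tangent" where
  "frame_W A \<phi> \<xi> g \<epsilon> \<epsilon>1 I C t = (let b = curve_b A \<phi> g I C in
     (\<epsilon>1 * \<epsilon>) *\<^sub>R (\<xi> (C t) +
       (vector_derivative b (at t within I) / (2 * (b t)\<^sup>2)) *\<^sub>R velocity A I C t))"

definition is_frame_N ::
    "'a chart set \<Rightarrow> ('a \<Rightarrow> 'a tangent \<Rightarrow> 'a tangent \<Rightarrow> real) \<Rightarrow> real set \<Rightarrow> (real \<Rightarrow> 'a) \<Rightarrow>
     (real \<Rightarrow> 'a tangent) \<Rightarrow> (real \<Rightarrow> 'a tangent) \<Rightarrow> bool" where
  "is_frame_N A g I C W N \<longleftrightarrow> (\<forall>t\<in>I. N t \<in> tangent_space A (C t) \<and>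
     g (C t) (velocity A I C t) (N t) = 1 \<and> g (C t) (N t) (N t) = 0 \<and> g (C t) (N t) (W t) = 0)"

definition frame_curvatures ::
    "'a chart set \<Rightarrow> 'a conn \<Rightarrow> real set \<Rightarrow> (real \<Rightarrow> 'a) \<Rightarrow> (real \<Rightarrow> 'a tangent) \<Rightarrow>
     (real \<Rightarrow> 'a tangent) \<Rightarrow> (real \<Rightarrow> real) \<Rightarrow> (real \<Rightarrow> real) \<Rightarrow> bool" where
  "frame_curvatures A \<Gamma> I C N W k1 k2 \<longleftrightarrow> (\<forall>t\<in>I.
     nabla_along A \<Gamma> I C (velocity A I C) t = k1 t *\<^sub>R W t \<and>
     nabla_along A \<Gamma> I C N t = k2 t *\<^sub>R W t \<and>
     nabla_along A \<Gamma> I C W t = - (k2 t *\<^sub>R velocity A I C t) - k1 t *\<^sub>R N t)"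

end

theory Submission
  imports Defs
begin

text \<open>Write \<open>V\<close> for the velocity of the curve and \<open>b = g(V,\<phi>V)\<close>. Because \<open>\<nabla>\<^sub>V\<xi> = -\<phi>V\<close> on a
  Sasaki-like manifold (\<open>nabla_xi\<close>), differentiating the Legendre condition \<open>\<eta>(V) = 0\<close> along the
  curve gives \<open>\<eta>(\<nabla>\<^sub>VV) = b\<close> (\<open>legendre_acceleration_eta\<close>). The frame equation is
  \<open>\<nabla>\<^sub>VV = k\<^sub>1W\<close>, and \<open>\<eta>(W) = \<epsilon>\<^sub>1\<epsilon>\<close>, so \<open>b = \<epsilon>\<^sub>1\<epsilon>k\<^sub>1\<close>: a constant first curvature makes \<open>b\<close>
  constant. Then the coefficient of \<open>V\<close> in \<open>W\<close>, a multiple of the derivative of \<open>b\<close>, vanishes and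
  \<open>\<nabla>\<^sub>VV = b\<xi>\<close>.

  The Levi-Civita connections of the two metrics differ by the tensor
  \<open>-(g(X,\<phi>Y) - g(\<phi>X,\<phi>Y))\<xi>\<close> (\<open>associated_connection_difference\<close>, a Koszul-type computation). On
  the null Legendre vector \<open>V\<close> this is \<open>-b\<xi>\<close>, so the acceleration with respect to the associated
  metric is \<open>b\<xi> - b\<xi> = 0\<close> already in the given parameter. That metric takes the value \<open>b\<close> on
  \<open>(V,V)\<close>, and \<open>b\<close> is not zero because \<open>V\<close>, \<open>\<phi>V\<close>, \<open>\<xi>\<close> is a basis of the tangent space and \<open>g\<close>
  is nondegenerate (\<open>null_legendre_vector_b_nonzero\<close>). So the speed is a nonzero constant, arc
  length is an affine function of the parameter, and passing to it multiplies the velocity by a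
  constant: causal character, the Legendre condition and the geodesic equation are preserved.

  A tangent vector is a coherent family of component vectors, and forms and metrics are constrained
  on tangent vectors only. Computations take place in one chart, with the coordinate fields
  \<open>coord_field c v\<close>; to apply a metric to a covariant derivative it must first be known to be a
  tangent vector again (\<open>nabla_in_tangent_space\<close>).\<close>


section \<open>Differential calculus within a set\<close>

text \<open>Product rule for a family of linear maps applied to a vector. The hypotheses concern only the
  functions \<open>L x v\<close> with \<open>v\<close> fixed, which is the form in which smoothness of tensor fields and
  of Jacobians is given; in the proof the increment of \<open>Y\<close> is expanded in a basis.\<close>

lemma has_derivative_linear_family:
  fixes L :: "'a::real_normed_vector \<Rightarrow> 'v::euclidean_space \<Rightarrow> 'w::real_normed_vector"
  assumes lin: "\<And>x. x \<in> S \<Longrightarrow> linear (L x)" and a: "a \<in> S"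
    and L: "\<And>v. ((\<lambda>x. L x v) has_derivative (\<lambda>u. L' u v)) (at a within S)"
    and Y: "(Y has_derivative Y') (at a within S)"
  shows "((\<lambda>x. L x (Y x)) has_derivative (\<lambda>u. L' u (Y a) + L a (Y' u))) (at a within S)"
proof -
  \<comment> \<open>A linear map is determined by its values on the basis.\<close>
  have rep: "L x w = (\<Sum>i\<in>Basis. (w \<bullet> i) *\<^sub>R L x i)" if "x \<in> S" for x w
  proof -
    have "L x w = L x (\<Sum>i\<in>Basis. (w \<bullet> i) *\<^sub>R i)" by (simp add: euclidean_representation)
    then show ?thesis using lin[OF that] by (simp add: linear_sum linear_cmul)
  qed
  have "((\<lambda>x. L x (Y a) + (\<Sum>i\<in>Basis. ((Y x - Y a) \<bullet> i) *\<^sub>R L x i)) has_derivative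
      (\<lambda>u. L' u (Y a) + (\<Sum>i\<in>Basis. ((Y a - Y a) \<bullet> i) *\<^sub>R L' u i + ((Y' u - 0) \<bullet> i) *\<^sub>R L a i))) (at a within S)"
    by (intro derivative_intros L Y)
  then have *: "((\<lambda>x. L x (Y a) + (\<Sum>i\<in>Basis. ((Y x - Y a) \<bullet> i) *\<^sub>R L x i)) has_derivative
      (\<lambda>u. L' u (Y a) + L a (Y' u))) (at a within S)"
    by (simp add: rep[OF a, of "Y' _"])
  show ?thesis
  proof (rule has_derivative_transform[OF a _ *])
    fix x assume x: "x \<in> S"
    have "L x (Y x) = L x (Y a) + L x (Y x - Y a)"
      using linear_add[OF lin[OF x], of "Y a" "Y x - Y a"] by simp
    then show "L x (Y x) = L x (Y a) + (\<Sum>i\<in>Basis. ((Y x - Y a) \<bullet> i) *\<^sub>R L x i)"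
      using rep[OF x, of "Y x - Y a"] by simp
  qed
qed

lemma has_derivative_frechet_at:
  assumes "f differentiable (at x)"
  shows "(f has_derivative frechet_derivative f (at x)) (at x)"
  using assms by (simp add: frechet_derivative_works)

lemma frechet_derivative_at_eqI: "(f has_derivative f') (at x) \<Longrightarrow> frechet_derivative f (at x) = f'"
  by (rule frechet_derivative_at[symmetric])

lemma smooth_on_differentiable_at:
  assumes "smooth_on f S" "open S" "x \<in> S"
  shows "f differentiable (at x)"
proof -
  have "Ck_on (Suc 0) f S" using assms(1) by (simp only: smooth_on_def)
  then have "f differentiable (at x within S)" using assms(3) by simp
  then show ?thesis by (simp only: at_within_open[OF assms(3,2)])
qed

lemma smooth_on_frechet_derivative:
  assumes "smooth_on f S"
  shows "smooth_on (\<lambda>x. frechet_derivative f (at x within S) v) S"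
  unfolding smooth_on_def
proof
  fix k
  have "Ck_on (Suc k) f S" using assms by (simp only: smooth_on_def)
  then show "Ck_on k (\<lambda>x. frechet_derivative f (at x within S) v) S" by simp
qed

lemma Ck_on_cong:
  assumes "\<And>x. x \<in> S \<Longrightarrow> f x = h x" "Ck_on k f S"
  shows "Ck_on k h S"
  using assms
proof (induction k arbitrary: f h)
  case 0
  have "continuous_on S f" using "0.prems"(2) by simp
  then have "continuous_on S h" by (rule continuous_on_eq) (rule "0.prems"(1))
  then show ?case by simp
next
  case (Suc k)
  have iff: "(f has_derivative D) (at x within S) \<longleftrightarrow> (h has_derivative D) (at x within S)" if "x \<in> S" for x D
    using has_derivative_transform[OF that, of f h D] has_derivative_transform[OF that, of h f D] Suc.prems(1)
    by metis
  have diff: "f differentiable (at x within S) \<longleftrightarrow> h differentiable (at x within S)"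
    and frechet: "frechet_derivative f (at x within S) = frechet_derivative h (at x within S)" if "x \<in> S" for x
    by (simp_all add: differentiable_def frechet_derivative_def iff[OF that])
  have f: "\<forall>x\<in>S. f differentiable (at x within S)"
     "\<And>v. Ck_on k (\<lambda>x. frechet_derivative f (at x within S) v) S"
    using Suc.prems(2) by simp_all
  have "Ck_on k (\<lambda>x. frechet_derivative h (at x within S) v) S" for v
    by (rule Suc.IH[OF _ f(2)[of v]]) (rule fun_cong[OF frechet])
  moreover have "\<forall>x\<in>S. h differentiable (at x within S)"
    using f(1) diff by blast
  ultimately show ?case by simp
qed

lemma smooth_on_cong:
  assumes "\<And>x. x \<in> S \<Longrightarrow> f x = h x" "smooth_on f S"
  shows "smooth_on h S"
  using assms(2) Ck_on_cong[of S f h, OF assms(1)] by (simp add: smooth_on_def)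

lemma smooth_on_const: "open S \<Longrightarrow> smooth_on (\<lambda>x. v) S"
proof -
  assume S: "open S"
  have "Ck_on k (\<lambda>x::'a. v :: 'b) S" for k v
  proof (induction k arbitrary: v)
    case (Suc k)
    have "frechet_derivative (\<lambda>x. v) (at x within S) w = 0" if "x \<in> S" for x w
      by (simp add: at_within_open[OF that S])
    then have "Ck_on k (\<lambda>x. frechet_derivative (\<lambda>x::'a. v) (at x within S) w) S" for w
      by (intro Ck_on_cong[OF _ Suc[of 0]]) simp
    then show ?case by simp
  qed simp
  then show ?thesis by (simp add: smooth_on_def)
qed

lemma differentiable_transform:
  assumes "x \<in> S" "f differentiable (at x within S)" "\<And>y. y \<in> S \<Longrightarrow> h y = f y"
  shows "h differentiable (at x within S)"
  using has_derivative_transform[OF assms(1), of h f] assms(2,3) unfolding differentiable_def by blast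


section \<open>Charts, tangent vectors and covariant derivatives\<close>

locale atlas =
  fixes A :: "'a::{t2_space,second_countable_topology} chart set"
  assumes atlas: "smooth_atlas A"
begin

abbreviation T :: "'a \<Rightarrow> 'a tangent set" where "T \<equiv> tangent_space A"

abbreviation coord_field :: "'a chart \<Rightarrow> real^3 \<Rightarrow> 'a \<Rightarrow> 'a tangent" where
  "coord_field c v \<equiv> \<lambda>p. coord_vector A c p v"

lemma chart: "c \<in> A \<Longrightarrow> is_chart c"
  using atlas by (simp add: smooth_atlas_def)

lemma charts_at_iff: "c \<in> charts_at A p \<longleftrightarrow> c \<in> A \<and> p \<in> fst c"
  by (simp add: charts_at_def)

lemma open_image: "c \<in> A \<Longrightarrow> open (snd c ` fst c)"
  using chart by (auto simp: is_chart_def)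

lemma open_fst: "c \<in> A \<Longrightarrow> open (fst c)"
  using chart by (auto simp: is_chart_def)

lemma cinv_snd: "c \<in> A \<Longrightarrow> p \<in> fst c \<Longrightarrow> cinv c (snd c p) = p"
  using chart by (auto simp: is_chart_def homeomorphism_def)

lemma cinv_in: "x \<in> snd c ` fst c \<Longrightarrow> cinv c x \<in> fst c"
  by (rule inv_into_into)

lemma open_image_open:
  assumes "c \<in> A" "open U"
  shows "open (snd c ` (fst c \<inter> U))"
proof -
  have h: "homeomorphism (fst c) (snd c ` fst c) (snd c) (cinv c)"
    using chart[OF assms(1)] by (simp add: is_chart_def)
  have "openin (top_of_set (snd c ` fst c)) (snd c ` (fst c \<inter> U))"
    by (rule homeomorphism_imp_open_map[OF h]) (use assms in auto)
  then show ?thesis using open_image[OF assms(1)] openin_open_trans by blast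
qed

lemma transition_snd: "c \<in> A \<Longrightarrow> p \<in> fst c \<Longrightarrow> transition c c' (snd c p) = snd c' p"
  by (simp add: transition_def cinv_snd)

lemma smooth_transition:
  "c \<in> A \<Longrightarrow> c' \<in> A \<Longrightarrow> smooth_on (transition c c') (snd c ` (fst c \<inter> fst c'))"
  using atlas by (simp add: smooth_atlas_def)

lemma transition_has_derivative:
  assumes "c \<in> charts_at A p" "c' \<in> charts_at A p"
  shows "(transition c c' has_derivative transition_deriv c c' p) (at (snd c p))"
proof -
  have "transition c c' differentiable (at (snd c p))"
    using smooth_on_differentiable_at[OF smooth_transition open_image_open[OF _ open_fst]] assms
    by (auto simp: charts_at_iff)
  then show ?thesis
    using has_derivative_frechet_at unfolding transition_deriv_def by blast
qed

lemma linear_transition_deriv: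
  "c \<in> charts_at A p \<Longrightarrow> c' \<in> charts_at A p \<Longrightarrow> linear (transition_deriv c c' p)"
  using transition_has_derivative has_derivative_linear by blast

lemma transition_deriv_self:
  assumes "c \<in> charts_at A p"
  shows "transition_deriv c c p v = v"
proof -
  have c: "c \<in> A" "p \<in> fst c" using assms by (auto simp: charts_at_iff)
  have "(transition c c has_derivative (\<lambda>v. v)) (at (snd c p))"
    by (rule has_derivative_transform_within_open[OF has_derivative_ident open_image[OF c(1)]])
       (use c in \<open>auto simp: transition_snd\<close>)
  then have "frechet_derivative (transition c c) (at (snd c p)) = (\<lambda>v. v)"
    by (rule frechet_derivative_at_eqI)
  then show ?thesis by (simp add: transition_deriv_def)
qed

text \<open>The chain rule for \<open>transition c c'' = transition c' c'' \<circ> transition c c'\<close>, which is what makes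
  \<open>coord_vector\<close> satisfy the compatibility conditions of a tangent vector.\<close>

lemma transition_deriv_trans:
  assumes "c \<in> charts_at A p" "c' \<in> charts_at A p" "c'' \<in> charts_at A p"
  shows "transition_deriv c' c'' p (transition_deriv c c' p v) = transition_deriv c c'' p v"
proof -
  have c: "c \<in> A" "p \<in> fst c" "c' \<in> A" "p \<in> fst c'" using assms by (auto simp: charts_at_iff)
  have "(transition c' c'' \<circ> transition c c' has_derivative
      transition_deriv c' c'' p \<circ> transition_deriv c c' p) (at (snd c p))"
    by (rule diff_chain_at[OF transition_has_derivative[OF assms(1,2)]])
       (simp only: transition_snd[OF c(1,2)] transition_has_derivative[OF assms(2,3)])
  then have "(transition c c'' has_derivative
      transition_deriv c' c'' p \<circ> transition_deriv c c' p) (at (snd c p))"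
    by (rule has_derivative_transform_within_open[OF _ open_image_open[OF c(1) open_fst[OF c(3)]]])
       (use c in \<open>auto simp: transition_snd\<close>)
  then have "frechet_derivative (transition c c'') (at (snd c p)) =
      transition_deriv c' c'' p \<circ> transition_deriv c c' p"
    by (rule frechet_derivative_at_eqI)
  then show ?thesis unfolding transition_deriv_def[of c c''] by simp
qed

text \<open>The defining equations, oriented so that rewriting from left to right terminates.\<close>

lemma tangent_space_iff: "u \<in> T p \<longleftrightarrow> (\<forall>c. c \<notin> charts_at A p \<longrightarrow> u c = 0) \<and>
    (\<forall>c\<in>charts_at A p. \<forall>c'\<in>charts_at A p. transition_deriv c c' p (u c) = u c')"
  unfolding tangent_space_def mem_Collect_eq by metis

lemma coord_vector_self: "c \<in> charts_at A p \<Longrightarrow> coord_vector A c p v c = v"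
  by (simp add: coord_vector_def transition_deriv_self)

lemma coord_vector_in: "c \<in> charts_at A p \<Longrightarrow> coord_vector A c p v \<in> T p"
  by (auto simp: coord_vector_def tangent_space_iff transition_deriv_trans)

text \<open>Together with \<open>coord_vector_self\<close> and \<open>coord_vector_in\<close>: taking components in a chart identifies
  the tangent space with \<open>real^3\<close>.\<close>

lemma coord_vector_component:
  assumes "c \<in> charts_at A p" "u \<in> T p"
  shows "coord_vector A c p (u c) = u"
proof
  fix c'
  show "coord_vector A c p (u c) c' = u c'"
    using assms unfolding coord_vector_def tangent_space_iff by metis
qed

lemma tangent_eqI:
  assumes "c \<in> charts_at A p" "u \<in> T p" "v \<in> T p" "u c = v c"
  shows "u = v"
  using coord_vector_component assms by metis

lemma tangent_spaceI:
  assumes c: "c \<in> charts_at A p" and 0: "\<And>c'. c' \<notin> charts_at A p \<Longrightarrow> u c' = 0"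
    and u: "\<And>c'. c' \<in> charts_at A p \<Longrightarrow> u c' = transition_deriv c c' p (u c)"
  shows "u \<in> T p"
proof -
  have "coord_vector A c p (u c) c' = u c'" for c'
    using 0[of c'] u[of c'] unfolding coord_vector_def by metis
  then have "u = coord_vector A c p (u c)" by (intro ext) simp
  then show ?thesis using coord_vector_in[OF c] by metis
qed

lemma tangent_add: "u \<in> T p \<Longrightarrow> v \<in> T p \<Longrightarrow> u + v \<in> T p"
  by (auto simp: tangent_space_iff linear_add[OF linear_transition_deriv])

lemma tangent_scaleR: "u \<in> T p \<Longrightarrow> r *\<^sub>R u \<in> T p"
  by (auto simp: tangent_space_iff scaleR_fun_def linear_cmul[OF linear_transition_deriv])

lemma tangent_uminus: "u \<in> T p \<Longrightarrow> - u \<in> T p"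
  using tangent_scaleR[of u p "-1"] by simp

lemma tangent_diff: "u \<in> T p \<Longrightarrow> v \<in> T p \<Longrightarrow> u - v \<in> T p"
  using tangent_add[of u p "-v"] tangent_uminus[of v p] by simp

lemma linear_coord_vector: "c \<in> charts_at A p \<Longrightarrow> linear (coord_vector A c p)"
  by (rule linearI) (auto simp: coord_vector_def fun_eq_iff scaleR_fun_def
       linear_add[OF linear_transition_deriv] linear_cmul[OF linear_transition_deriv])

lemma coord_field_is_field: "c \<in> A \<Longrightarrow> vector_field_on_chart A c (coord_field c v)"
  unfolding vector_field_on_chart_def
proof safe
  assume c: "c \<in> A"
  show "smooth_on (\<lambda>x. coord_vector A c (cinv c x) v c) (snd c ` fst c)"
    by (rule smooth_on_cong[where f = "\<lambda>x. v", OF _ smooth_on_const[OF open_image[OF c]]])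
       (use c in \<open>simp add: cinv_in coord_vector_self charts_at_iff\<close>)
qed (simp add: coord_vector_in charts_at_iff)

lemma field_has_derivative:
  assumes "vector_field_on_chart A c Y" "c \<in> charts_at A p"
  shows "((\<lambda>x. Y (cinv c x) c) has_derivative frechet_derivative (\<lambda>x. Y (cinv c x) c) (at (snd c p)))
    (at (snd c p))"
proof (rule has_derivative_frechet_at, rule smooth_on_differentiable_at)
  show "smooth_on (\<lambda>x. Y (cinv c x) c) (snd c ` fst c)"
    using assms(1) by (simp add: vector_field_on_chart_def)
qed (use assms(2) open_image in \<open>simp_all add: charts_at_iff\<close>)

lemma transition_deriv_has_derivative:
  assumes "c \<in> charts_at A p" "c' \<in> charts_at A p"
  shows "((\<lambda>x. frechet_derivative (transition c c') (at x) w) has_derivative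
    frechet_derivative (\<lambda>x. frechet_derivative (transition c c') (at x) w) (at (snd c p)))
    (at (snd c p))"
proof -
  let ?S = "snd c ` (fst c \<inter> fst c')"
  have S: "open ?S" and c: "c \<in> A" "p \<in> fst c" "c' \<in> A" "p \<in> fst c'"
    using open_image_open[OF _ open_fst] assms by (auto simp: charts_at_iff)
  have "smooth_on (\<lambda>x. frechet_derivative (transition c c') (at x) w) ?S"
    by (rule smooth_on_cong[OF _ smooth_on_frechet_derivative[OF smooth_transition[OF c(1,3)]]])
       (simp add: at_within_open[OF _ S])
  from smooth_on_differentiable_at[OF this S] show ?thesis
    using c by (intro has_derivative_frechet_at) auto
qed

text \<open>Differentiating \<open>Y c' = (D\<tau>) (Y c)\<close>, where \<open>\<tau>\<close> is the transition map, produces a second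
  derivative of \<open>\<tau>\<close>; the inhomogeneous term in the transformation law of the connection
  coefficients cancels it.\<close>

lemma nabla_in_tangent_space:
  assumes con: "connection A \<Gamma>" and c: "c \<in> charts_at A p"
    and X: "X p \<in> T p" and Y: "vector_field_on_chart A c Y"
  shows "nabla A \<Gamma> X Y p \<in> T p"
proof (rule tangent_spaceI[OF c])
  fix c' assume c': "c' \<in> charts_at A p"
  have cA: "c \<in> A" "p \<in> fst c" "c' \<in> A" "p \<in> fst c'" using c c' by (auto simp: charts_at_iff)
  let ?S = "snd c ` (fst c \<inter> fst c')"
  let ?x = "snd c p"
  let ?D = "\<lambda>x. frechet_derivative (transition c c') (at x)"
  let ?Y = "\<lambda>x. Y (cinv c x) c"
  let ?Y' = "frechet_derivative ?Y (at ?x)"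
  let ?H = "\<lambda>u w. frechet_derivative (\<lambda>x. ?D x w) (at ?x) u"
  have S: "open ?S" using open_image_open[OF cA(1) open_fst[OF cA(3)]] .
  have xS: "?x \<in> ?S" using cA by auto
  have YT: "Y q \<in> T q" if "q \<in> fst c" for q
    using Y that by (simp add: vector_field_on_chart_def)
  \<comment> \<open>The components of \<open>Y\<close> in \<open>c'\<close>, as a function of the coordinates of \<open>c\<close>.\<close>
  have G: "((\<lambda>x. ?D x (?Y x)) has_derivative (\<lambda>u. ?H u (?Y ?x) + ?D ?x (?Y' u))) (at ?x within ?S)"
  proof (rule has_derivative_linear_family[where L = ?D and Y = ?Y, OF _ xS])
    show "linear (?D x)" if "x \<in> ?S" for x
      using that linear_transition_deriv[of c _ c'] cA by (auto simp: transition_deriv_def[abs_def] charts_at_iff)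
    show "((\<lambda>x. ?D x v) has_derivative (\<lambda>u. ?H u v)) (at ?x within ?S)" for v
      using transition_deriv_has_derivative[OF c c'] has_derivative_at_withinI by blast
    show "(?Y has_derivative ?Y') (at ?x within ?S)"
      using field_has_derivative[OF Y c] has_derivative_at_withinI by blast
  qed
  then have G: "((\<lambda>x. ?D x (?Y x)) has_derivative (\<lambda>u. ?H u (?Y ?x) + ?D ?x (?Y' u))) (at ?x)"
    by (simp add: at_within_open[OF xS S])
  have "((\<lambda>x. ?D x (?Y x)) \<circ> transition c' c has_derivative
      (\<lambda>u. ?H u (?Y ?x) + ?D ?x (?Y' u)) \<circ> transition_deriv c' c p) (at (snd c' p))"
    by (rule diff_chain_at[OF transition_has_derivative[OF c' c]])
       (use G in \<open>simp add: transition_snd[OF cA(3,4)]\<close>)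
  then have "((\<lambda>y. Y (cinv c' y) c') has_derivative
      (\<lambda>u. ?H u (?Y ?x) + ?D ?x (?Y' u)) \<circ> transition_deriv c' c p) (at (snd c' p))"
  proof (rule has_derivative_transform_within_open[OF _ open_image_open[OF cA(3) open_fst[OF cA(1)]]])
    fix y assume "y \<in> snd c' ` (fst c' \<inter> fst c)"
    then obtain q where q: "q \<in> fst c'" "q \<in> fst c" "y = snd c' q" by auto
    then show "((\<lambda>x. ?D x (?Y x)) \<circ> transition c' c) y = Y (cinv c' y) c'"
      using YT[OF q(2)] cA
      by (auto simp: transition_snd cinv_snd tangent_space_iff charts_at_iff transition_deriv_def)
  qed (use cA in auto)
  then have "frechet_derivative (\<lambda>y. Y (cinv c' y) c') (at (snd c' p)) =
      (\<lambda>u. ?H u (?Y ?x) + ?D ?x (?Y' u)) \<circ> transition_deriv c' c p"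
    by (rule frechet_derivative_at_eqI)
  moreover have Xc: "transition_deriv c c' p (X p c) = X p c'" "transition_deriv c' c p (X p c') = X p c"
     "transition_deriv c c' p (Y p c) = Y p c'"
    using X YT[OF cA(2)] c c' by (auto simp: tangent_space_iff)
  moreover have "transition_deriv c c' p (\<Gamma> c p (X p c) (Y p c)) =
          \<Gamma> c' p (X p c') (Y p c') + ?H (X p c) (Y p c)"
  proof -
    have "p \<in> manifold_carrier A" using cA by (auto simp: manifold_carrier_def)
    then show ?thesis using con c c' unfolding connection_def Xc(1,3)[symmetric] by blast
  qed
  ultimately show "nabla A \<Gamma> X Y p c' = transition_deriv c c' p (nabla A \<Gamma> X Y p c)"
    using c c' cA
    by (simp add: nabla_def linear_add[OF linear_transition_deriv[OF c c']] cinv_snd)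
       (simp add: transition_deriv_def)
qed (simp add: nabla_def)

lemma dir_deriv_cong:
  assumes "c \<in> charts_at A p" "\<And>q. q \<in> fst c \<Longrightarrow> f q = h q"
  shows "dir_deriv c f p v = dir_deriv c h p v"
proof -
  have c: "c \<in> A" "p \<in> fst c" using assms(1) by (simp_all add: charts_at_iff)
  have "((\<lambda>x. f (cinv c x)) has_derivative D) (at (snd c p)) \<longleftrightarrow>
      ((\<lambda>x. h (cinv c x)) has_derivative D) (at (snd c p))" for D
    using has_derivative_transform_within_open[OF _ open_image[OF c(1)], of "\<lambda>x. f (cinv c x)" D "snd c p" UNIV "\<lambda>x. h (cinv c x)"]
     has_derivative_transform_within_open[OF _ open_image[OF c(1)], of "\<lambda>x. h (cinv c x)" D "snd c p" UNIV "\<lambda>x. f (cinv c x)"]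
     imageI[OF c(2), of "snd c"] assms(2)[OF cinv_in] by metis
  then show ?thesis unfolding dir_deriv_def frechet_derivative_def by simp
qed

lemma dir_deriv_const: "dir_deriv c (\<lambda>q. r) p v = 0"
  by (simp add: dir_deriv_def)

lemma dir_deriv_add:
  assumes "(\<lambda>x. f (cinv c x)) differentiable (at (snd c p))"
    "(\<lambda>x. h (cinv c x)) differentiable (at (snd c p))"
  shows "dir_deriv c (\<lambda>q. f q + h q) p v = dir_deriv c f p v + dir_deriv c h p v"
  unfolding dir_deriv_def
  by (subst frechet_derivative_at_eqI[OF has_derivative_add[OF assms[THEN has_derivative_frechet_at]]]) simp

lemma dir_deriv_mult:
  assumes "(\<lambda>x. f (cinv c x)) differentiable (at (snd c p))"
    "(\<lambda>x. h (cinv c x)) differentiable (at (snd c p))" and "c \<in> charts_at A p"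
  shows "dir_deriv c (\<lambda>q. f q * h q) p v = f p * dir_deriv c h p v + dir_deriv c f p v * h p"
proof -
  have "cinv c (snd c p) = p" using assms(3) by (simp add: charts_at_iff cinv_snd)
  then show ?thesis
    unfolding dir_deriv_def
    by (subst frechet_derivative_at_eqI[OF has_derivative_mult[OF assms(1,2)[THEN has_derivative_frechet_at]]]) simp
qed

lemma nabla_component:
  "c \<in> charts_at A p \<Longrightarrow> nabla A \<Gamma> X Y p c =
     frechet_derivative (\<lambda>x. Y (cinv c x) c) (at (snd c p)) (X p c) + \<Gamma> c p (X p c) (Y p c)"
  by (simp add: nabla_def)

lemma coord_field_derivative:
  assumes "c \<in> charts_at A p"
  shows "frechet_derivative (\<lambda>x. coord_field c v (cinv c x) c) (at (snd c p)) = (\<lambda>u. 0)"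
proof (rule frechet_derivative_at_eqI)
  have c: "c \<in> A" "p \<in> fst c" using assms by (simp_all add: charts_at_iff)
  show "((\<lambda>x. coord_field c v (cinv c x) c) has_derivative (\<lambda>u. 0)) (at (snd c p))"
    by (rule has_derivative_transform_within_open[OF has_derivative_const[of v] open_image[OF c(1)]])
       (use c in \<open>simp_all add: cinv_in coord_vector_self charts_at_iff\<close>)
qed

lemma nabla_coord_field:
  assumes "connection A \<Gamma>" "c \<in> charts_at A p"
  shows "nabla A \<Gamma> (coord_field c u) (coord_field c v) p = coord_vector A c p (\<Gamma> c p u v)"
proof (rule tangent_eqI[OF assms(2)])
  show "nabla A \<Gamma> (coord_field c u) (coord_field c v) p \<in> T p"
    using assms by (intro nabla_in_tangent_space[OF assms]) (simp_all add: coord_vector_in coord_field_is_field charts_at_iff)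
  show "nabla A \<Gamma> (coord_field c u) (coord_field c v) p c = coord_vector A c p (\<Gamma> c p u v) c"
    using assms(2) by (simp add: nabla_component coord_field_derivative coord_vector_self)
qed (simp add: coord_vector_in assms)

text \<open>Coordinate fields commute, so that vanishing torsion says that the coefficients are symmetric.\<close>

lemma levi_civita_symmetric:
  assumes "levi_civita A g \<Gamma>" "c \<in> charts_at A p"
  shows "\<Gamma> c p u v = \<Gamma> c p v u"
proof -
  let ?U = "coord_field c u" and ?V = "coord_field c v"
  have "nabla A \<Gamma> ?U ?V p - nabla A \<Gamma> ?V ?U p = lie_bracket A ?U ?V p"
    using assms coord_field_is_field unfolding levi_civita_def charts_at_iff by blast
  moreover have "lie_bracket A ?U ?V p c = 0"
    using assms(2) by (simp add: lie_bracket_def coord_field_derivative)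
  ultimately have "(nabla A \<Gamma> ?U ?V p - nabla A \<Gamma> ?V ?U p) c = 0" by simp
  then show ?thesis
    using assms(2) by (simp add: nabla_component coord_field_derivative coord_vector_self)
qed

lemma levi_civita_metric:
  assumes "levi_civita A g \<Gamma>" "c \<in> charts_at A p"
    "vector_field_on_chart A c X" "vector_field_on_chart A c Y" "vector_field_on_chart A c Z"
  shows "dir_deriv c (\<lambda>q. g q (Y q) (Z q)) p (X p) =
           g p (nabla A \<Gamma> X Y p) (Z p) + g p (Y p) (nabla A \<Gamma> X Z p)"
  using assms unfolding levi_civita_def charts_at_iff by blast

end


section \<open>Sasaki-like manifolds\<close>

lemma linear_on_add: "linear_on T f \<Longrightarrow> u \<in> T \<Longrightarrow> v \<in> T \<Longrightarrow> f (u + v) = f u + f v"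
  unfolding linear_on_def by (metis scaleR_one)

lemma linear_on_scaleR: "linear_on T f \<Longrightarrow> u \<in> T \<Longrightarrow> f (r *\<^sub>R u) = r *\<^sub>R f u"
  unfolding linear_on_def by (metis add.right_neutral scaleR_zero_left)

lemma linear_on_uminus: "linear_on T f \<Longrightarrow> u \<in> T \<Longrightarrow> f (- u) = - f u"
  using linear_on_scaleR[of T f u "-1"] by simp

lemma linear_on_diff:
  assumes "linear_on T f" "u \<in> T" "v \<in> T" shows "f (u - v) = f u - f v"
proof -
  have "f (1 *\<^sub>R u + (-1) *\<^sub>R v) = 1 *\<^sub>R f u + (-1) *\<^sub>R f v"
    using assms unfolding linear_on_def by blast
  then show ?thesis by simp
qed

locale sasaki_manifold =
  fixes A :: "'a::{t2_space,second_countable_topology} chart set"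
    and \<phi> :: "'a \<Rightarrow> 'a tangent \<Rightarrow> 'a tangent"
    and \<xi> :: "'a \<Rightarrow> 'a tangent"
    and \<eta> :: "'a \<Rightarrow> 'a tangent \<Rightarrow> real"
    and g :: "'a \<Rightarrow> 'a tangent \<Rightarrow> 'a tangent \<Rightarrow> real"
    and \<Gamma> :: "'a conn"
  assumes sasaki_like: "sasaki_like A \<phi> \<xi> \<eta> g \<Gamma>"

sublocale sasaki_manifold \<subseteq> atlas A
  using sasaki_like by unfold_locales (simp add: sasaki_like_def almost_contact_B_metric_def)

context sasaki_manifold
begin

lemma structure_tensors:
  shows endo: "endomorphism_field A \<phi>" and xi: "vector_field A \<xi>" and eta: "one_form A \<eta>"
    and metric: "pseudo_riemannian_metric A g" and lc: "levi_civita A g \<Gamma>"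
    and con: "connection A \<Gamma>"
  using sasaki_like by (simp_all add: sasaki_like_def almost_contact_B_metric_def levi_civita_def)

lemma chart_carrier: "c \<in> charts_at A p \<Longrightarrow> p \<in> manifold_carrier A"
  by (auto simp: charts_at_iff manifold_carrier_def)

context
  fixes p assumes p: "p \<in> manifold_carrier A"
begin

lemma phi_linear: "linear_on (T p) (\<phi> p)" and phi_in: "u \<in> T p \<Longrightarrow> \<phi> p u \<in> T p"
  using endo p by (auto simp: endomorphism_field_def)

lemma xi_in: "\<xi> p \<in> T p"
  using xi p by (auto simp: vector_field_def vector_field_on_chart_def manifold_carrier_def)

lemma eta_linear: "linear_on (T p) (\<eta> p)"
  using eta p by (simp add: one_form_def)

lemma g_linear: "u \<in> T p \<Longrightarrow> linear_on (T p) (g p u)"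
  and g_sym: "u \<in> T p \<Longrightarrow> v \<in> T p \<Longrightarrow> g p u v = g p v u"
  using metric p by (auto simp: pseudo_riemannian_metric_def Let_def)

lemma g_nondeg: "u \<in> T p \<Longrightarrow> (\<And>v. v \<in> T p \<Longrightarrow> g p u v = 0) \<Longrightarrow> u = 0"
  using metric p by (auto simp: pseudo_riemannian_metric_def Let_def)

lemmas tangent = tangent_add tangent_diff tangent_uminus tangent_scaleR xi_in phi_in

lemmas phi_simps = linear_on_add[OF phi_linear] linear_on_diff[OF phi_linear]
  linear_on_uminus[OF phi_linear] linear_on_scaleR[OF phi_linear]

lemmas eta_simps = linear_on_add[OF eta_linear] linear_on_diff[OF eta_linear]
  linear_on_uminus[OF eta_linear] linear_on_scaleR[OF eta_linear]

lemmas g_right_simps = linear_on_add[OF g_linear] linear_on_diff[OF g_linear]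
  linear_on_uminus[OF g_linear] linear_on_scaleR[OF g_linear]

lemma g_left_simps:
  assumes "w \<in> T p" "u \<in> T p"
  shows "v \<in> T p \<Longrightarrow> g p (u + v) w = g p u w + g p v w" "v \<in> T p \<Longrightarrow> g p (u - v) w = g p u w - g p v w"
    "g p (- u) w = - g p u w" "g p (r *\<^sub>R u) w = r * g p u w"
  using assms by (simp_all add: g_sym[of _ w] tangent g_right_simps)

lemma contact:
  shows eta_xi: "\<eta> p (\<xi> p) = 1"
    and phi_phi: "u \<in> T p \<Longrightarrow> \<phi> p (\<phi> p u) = - u + \<eta> p u *\<^sub>R \<xi> p"
    and g_phi_phi: "u \<in> T p \<Longrightarrow> v \<in> T p \<Longrightarrow> g p (\<phi> p u) (\<phi> p v) = - g p u v + \<eta> p u * \<eta> p v"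
  using sasaki_like p by (auto simp: sasaki_like_def almost_contact_B_metric_def)

lemma xi_nonzero: "\<xi> p \<noteq> 0"
proof
  assume "\<xi> p = 0"
  then have "\<eta> p (\<xi> p) = \<eta> p (0 *\<^sub>R \<xi> p)" by simp
  also have "\<dots> = 0" by (subst eta_simps) (simp_all add: xi_in)
  finally show False using eta_xi by simp
qed

text \<open>Evaluate \<open>\<phi>\<^sup>3u\<close> as \<open>\<phi>\<^sup>2(\<phi>u)\<close> and as \<open>\<phi>(\<phi>\<^sup>2u)\<close>.\<close>

lemma eta_phi_xi_eq: "u \<in> T p \<Longrightarrow> \<eta> p (\<phi> p u) *\<^sub>R \<xi> p = \<eta> p u *\<^sub>R \<phi> p (\<xi> p)"
  using phi_phi[of "\<phi> p u"] phi_phi[of u] by (simp add: tangent phi_simps)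

text \<open>By \<open>eta_phi_xi_eq\<close> the vector \<open>\<phi>\<xi>\<close> is a multiple of \<open>\<xi>\<close>. As \<open>\<phi>\<^sup>2\<xi> = 0\<close>, the square of the factor
  annihilates \<open>\<xi>\<close>, and \<open>\<xi>\<close> is not zero.\<close>

lemma phi_xi: "\<phi> p (\<xi> p) = 0"
proof -
  have *: "\<eta> p (\<phi> p (\<xi> p)) *\<^sub>R \<xi> p = \<phi> p (\<xi> p)"
    using eta_phi_xi_eq[OF xi_in] by (simp add: eta_xi)
  have "\<phi> p (\<phi> p (\<xi> p)) = 0" by (simp add: phi_phi xi_in eta_xi)
  then have "\<eta> p (\<phi> p (\<xi> p)) *\<^sub>R \<phi> p (\<xi> p) = 0"
    using * by (metis phi_simps(4) xi_in)
  with * show ?thesis by (metis scaleR_eq_0_iff)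
qed

lemma eta_phi: "u \<in> T p \<Longrightarrow> \<eta> p (\<phi> p u) = 0"
  using eta_phi_xi_eq[of u] xi_nonzero by (simp add: phi_xi)

lemma g_zero_right: "u \<in> T p \<Longrightarrow> g p u 0 = 0"
  using g_right_simps(4)[of u u 0] by simp

text \<open>From \<open>g(\<phi>u,\<phi>\<xi>) = 0\<close>.\<close>

lemma g_xi: "u \<in> T p \<Longrightarrow> g p u (\<xi> p) = \<eta> p u"
  using g_phi_phi[of u "\<xi> p"] by (simp add: phi_xi xi_in eta_xi g_zero_right phi_in)

lemma g_xi_left: "u \<in> T p \<Longrightarrow> g p (\<xi> p) u = \<eta> p u"
  using g_xi g_sym xi_in by metis

lemma g_phi_sym: "u \<in> T p \<Longrightarrow> v \<in> T p \<Longrightarrow> g p (\<phi> p u) v = g p u (\<phi> p v)"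
  using g_phi_phi[of u "\<phi> p v"]
  by (simp add: phi_phi tangent eta_phi g_right_simps g_xi)

text \<open>Testing against \<open>\<xi>\<close> gives \<open>\<eta>(u) = 0\<close>; then testing against \<open>\<phi>w\<close> gives \<open>g(u,w) = 0\<close>,
  because \<open>\<phi>\<^sup>2w\<close> differs from \<open>-w\<close> by a multiple of \<open>\<xi>\<close>.\<close>

lemma associated_metric_nondeg:
  assumes u: "u \<in> T p" and 0: "\<And>v. v \<in> T p \<Longrightarrow> associated_metric \<phi> \<eta> g p u v = 0"
  shows "u = 0"
proof (rule g_nondeg[OF u])
  fix w assume w: "w \<in> T p"
  have eta: "\<eta> p u = 0"
    using 0[OF xi_in] u by (simp add: associated_metric_def phi_xi eta_xi g_zero_right)
  have "g p u (\<phi> p (\<phi> p w)) = 0"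
    using 0[of "\<phi> p w"] w by (simp add: associated_metric_def eta_phi tangent)
  then show "g p u w = 0"
    using u w eta by (simp add: phi_phi g_right_simps tangent g_xi)
qed

end

text \<open>Smoothness of the metric is stated for constant components; the components of \<open>Y\<close> vary, so the
  product rule for families of linear maps is applied in the second argument.\<close>

lemma g_field_differentiable:
  assumes c: "c \<in> charts_at A p" and Y: "vector_field_on_chart A c Y"
  shows "(\<lambda>x. g (cinv c x) (coord_vector A c (cinv c x) u) (Y (cinv c x))) differentiable (at (snd c p))"
proof -
  let ?S = "snd c ` fst c" and ?x = "snd c p"
  let ?L = "\<lambda>x w. g (cinv c x) (coord_vector A c (cinv c x) u) (coord_vector A c (cinv c x) w)"
  have cA: "c \<in> A" "p \<in> fst c" using c by (simp_all add: charts_at_iff)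
  have S: "open ?S" using open_image[OF cA(1)] .
  have xS: "?x \<in> ?S" using cA by simp
  have at: "c \<in> charts_at A (cinv c x)" "cinv c x \<in> manifold_carrier A" if "x \<in> ?S" for x
    using cA cinv_in[OF that] by (auto simp: charts_at_iff manifold_carrier_def)
  have "((\<lambda>x. ?L x (Y (cinv c x) c)) has_derivative
      (\<lambda>v. frechet_derivative (\<lambda>x. ?L x (Y (cinv c ?x) c)) (at ?x) v
         + ?L ?x (frechet_derivative (\<lambda>x. Y (cinv c x) c) (at ?x) v))) (at ?x within ?S)"
  proof (rule has_derivative_linear_family[where L = ?L and Y = "\<lambda>x. Y (cinv c x) c" and S = ?S, OF _ xS])
    fix x assume x: "x \<in> ?S"
    show "linear (?L x)"
    proof (rule linearI)
      show "?L x (v + w) = ?L x v + ?L x w" for v w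
        by (simp only: linear_add[OF linear_coord_vector[OF at(1)[OF x]]] g_right_simps[OF at(2)[OF x]] coord_vector_in[OF at(1)[OF x]])
      show "?L x (r *\<^sub>R v) = r *\<^sub>R ?L x v" for r v
        by (simp only: linear_cmul[OF linear_coord_vector[OF at(1)[OF x]]] g_right_simps[OF at(2)[OF x]] coord_vector_in[OF at(1)[OF x]])
    qed
  next
    fix w
    have "smooth_on (\<lambda>x. ?L x w) ?S"
      using metric cA(1) by (simp add: pseudo_riemannian_metric_def)
    then have "(\<lambda>x. ?L x w) differentiable (at ?x)"
      by (rule smooth_on_differentiable_at[OF _ S xS])
    then show "((\<lambda>x. ?L x w) has_derivative frechet_derivative (\<lambda>x. ?L x w) (at ?x)) (at ?x within ?S)"
      by (rule has_derivative_at_withinI[OF has_derivative_frechet_at])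
  next
    show "((\<lambda>x. Y (cinv c x) c) has_derivative frechet_derivative (\<lambda>x. Y (cinv c x) c) (at ?x)) (at ?x within ?S)"
      by (rule has_derivative_at_withinI[OF field_has_derivative[OF Y c]])
  qed
  then have "(\<lambda>x. ?L x (Y (cinv c x) c)) differentiable (at ?x within ?S)"
    by (rule differentiableI)
  moreover have "g (cinv c x) (coord_vector A c (cinv c x) u) (Y (cinv c x)) = ?L x (Y (cinv c x) c)"
    if "x \<in> ?S" for x
    using coord_vector_component[OF at(1)[OF that], of "Y (cinv c x)"] Y cinv_in[OF that]
    by (simp add: vector_field_on_chart_def)
  ultimately have "(\<lambda>x. g (cinv c x) (coord_vector A c (cinv c x) u) (Y (cinv c x))) differentiable (at ?x within ?S)"
    by (rule differentiable_transform[OF xS])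
  then show ?thesis by (simp only: at_within_open[OF xS S])
qed

lemma xi_field: "c \<in> A \<Longrightarrow> vector_field_on_chart A c \<xi>"
  using xi by (simp add: vector_field_def)

lemma in_carrier: "c \<in> A \<Longrightarrow> q \<in> fst c \<Longrightarrow> q \<in> manifold_carrier A"
  by (auto simp: manifold_carrier_def)

lemma phi_coord_field:
  assumes "c \<in> A"
  shows "vector_field_on_chart A c (\<lambda>q. \<phi> q (coord_field c v q))"
  unfolding vector_field_on_chart_def
proof
  show "\<forall>q\<in>fst c. \<phi> q (coord_field c v q) \<in> T q"
    using assms by (simp add: phi_in[OF in_carrier] coord_vector_in charts_at_iff)
  show "smooth_on (\<lambda>x. \<phi> (cinv c x) (coord_field c v (cinv c x)) c) (snd c ` fst c)"
    using endo assms by (simp add: endomorphism_field_def)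
qed

lemma nabla_in:
  assumes "c \<in> charts_at A p" "vector_field_on_chart A c X" "vector_field_on_chart A c Y"
  shows "nabla A \<Gamma> X Y p \<in> T p"
  using assms nabla_in_tangent_space[OF con assms(1) _ assms(3), of X]
  by (simp add: vector_field_on_chart_def charts_at_iff)

text \<open>The Sasaki-like identity, solved for the derivative of \<open>\<phi>Y\<close>.\<close>

lemma nabla_phi:
  assumes "c \<in> charts_at A p" "vector_field_on_chart A c X" "vector_field_on_chart A c Y"
  shows "nabla A \<Gamma> X (\<lambda>q. \<phi> q (Y q)) p = \<phi> p (nabla A \<Gamma> X Y p)
    - g p (X p) (Y p) *\<^sub>R \<xi> p - \<eta> p (Y p) *\<^sub>R X p + (2 * \<eta> p (X p) * \<eta> p (Y p)) *\<^sub>R \<xi> p"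
proof -
  have "nabla_endo A \<Gamma> \<phi> X Y p = - (g p (X p) (Y p) *\<^sub>R \<xi> p) - \<eta> p (Y p) *\<^sub>R X p
           + (2 * \<eta> p (X p) * \<eta> p (Y p)) *\<^sub>R \<xi> p"
    using sasaki_like assms unfolding sasaki_like_def charts_at_iff by blast
  then show ?thesis unfolding nabla_endo_def by (simp add: algebra_simps)
qed

lemma nabla_phi_xi:
  assumes c: "c \<in> charts_at A p"
  shows "nabla A \<Gamma> X (\<lambda>q. \<phi> q (\<xi> q)) p = 0"
proof
  fix c'
  show "nabla A \<Gamma> X (\<lambda>q. \<phi> q (\<xi> q)) p c' = 0 c'"
  proof (cases "c' \<in> charts_at A p")
    case True
    then have c': "c' \<in> A" "p \<in> fst c'" by (simp_all add: charts_at_iff)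
    have "((\<lambda>x. \<phi> (cinv c' x) (\<xi> (cinv c' x)) c') has_derivative (\<lambda>u. 0)) (at (snd c' p))"
      by (rule has_derivative_transform_within_open[OF has_derivative_const[of 0] open_image[OF c'(1)]])
         (use c' in \<open>simp_all add: cinv_in phi_xi[OF in_carrier]\<close>)
    then have "frechet_derivative (\<lambda>x. \<phi> (cinv c' x) (\<xi> (cinv c' x)) c') (at (snd c' p)) = (\<lambda>u. 0)"
      by (rule frechet_derivative_at_eqI)
    moreover have "bilinear (\<Gamma> c' p)" using con c' by (simp add: connection_def)
    ultimately show ?thesis
      using True c' by (simp add: nabla_component phi_xi[OF in_carrier] bilinear_rzero)
  qed (simp add: nabla_def)
qed

text \<open>The Sasaki-like identity for \<open>Y = \<xi>\<close> determines \<open>\<phi>(\<nabla>\<^sub>X\<xi>)\<close>, hence \<open>\<nabla>\<^sub>X\<xi>\<close> up to a multiple of \<open>\<xi>\<close>;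
  this multiple is zero because \<open>g(\<xi>,\<xi>) = 1\<close>.\<close>

lemma nabla_xi:
  assumes c: "c \<in> charts_at A p" and X: "vector_field_on_chart A c X"
  shows "nabla A \<Gamma> X \<xi> p = - \<phi> p (X p)"
proof -
  have cA: "c \<in> A" "p \<in> fst c" using c by (simp_all add: charts_at_iff)
  have p: "p \<in> manifold_carrier A" using in_carrier cA .
  let ?Z = "nabla A \<Gamma> X \<xi> p"
  have XT: "X p \<in> T p" using X cA by (simp add: vector_field_on_chart_def)
  have Z: "?Z \<in> T p" using nabla_in[OF c X xi_field[OF cA(1)]] .
  have "\<phi> p ?Z = X p - \<eta> p (X p) *\<^sub>R \<xi> p"
    using nabla_phi[OF c X xi_field[OF cA(1)]] XT
    by (simp add: nabla_phi_xi[OF c] g_xi[OF p] eta_xi[OF p] algebra_simps scaleR_2 flip: scaleR_scaleR)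
  then have "\<phi> p (\<phi> p ?Z) = \<phi> p (X p)"
    using XT by (simp add: phi_simps[OF p] tangent[OF p] phi_xi[OF p])
  then have *: "?Z = - \<phi> p (X p) + \<eta> p ?Z *\<^sub>R \<xi> p"
    using phi_phi[OF p Z] by (simp add: algebra_simps)
  have "dir_deriv c (\<lambda>q. g q (\<xi> q) (\<xi> q)) p (X p) = dir_deriv c (\<lambda>q. 1) p (X p)"
    by (rule dir_deriv_cong[OF c]) (use cA in_carrier in \<open>simp add: g_xi xi_in eta_xi\<close>)
  then have "\<eta> p ?Z = 0"
    using levi_civita_metric[OF lc c X xi_field[OF cA(1)] xi_field[OF cA(1)]] Z
    by (simp add: dir_deriv_const g_xi[OF p] g_xi_left[OF p])
  with * show ?thesis by simp
qed

text \<open>The covariant derivative of \<open>\<eta>\<close> is \<open>(\<nabla>\<^sub>U\<eta>)(V) = g(V,\<nabla>\<^sub>U\<xi>) = -g(V,\<phi>U)\<close>; for a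
  coordinate field \<open>V\<close> the derivative \<open>\<nabla>\<^sub>UV\<close> is given by the connection coefficients.\<close>

lemma dir_deriv_eta:
  assumes c: "c \<in> charts_at A p"
  defines "X \<equiv> \<lambda>u. coord_vector A c p u"
  shows "dir_deriv c (\<lambda>q. \<eta> q (coord_field c v q)) p (X u)
    = \<eta> p (X (\<Gamma> c p u v)) - g p (X v) (\<phi> p (X u))"
proof -
  have cA: "c \<in> A" "p \<in> fst c" using c by (simp_all add: charts_at_iff)
  note p = in_carrier[OF cA]
  have X: "X u \<in> T p" for u using coord_vector_in[OF c] by (simp add: X_def)
  note field = coord_field_is_field[OF cA(1)]
  have "dir_deriv c (\<lambda>q. \<eta> q (coord_field c v q)) p (X u)
      = dir_deriv c (\<lambda>q. g q (coord_field c v q) (\<xi> q)) p (X u)"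
    by (rule dir_deriv_cong[OF c])
       (use cA in_carrier in \<open>simp add: g_xi coord_vector_in charts_at_iff\<close>)
  also have "\<dots> = \<eta> p (X (\<Gamma> c p u v)) + g p (X v) (- \<phi> p (X u))"
    unfolding X_def
    by (subst levi_civita_metric[OF lc c field field xi_field[OF cA(1)]])
       (simp add: nabla_coord_field[OF con c] nabla_xi[OF c field] g_xi[OF p] coord_vector_in[OF c])
  finally show ?thesis by (simp add: g_right_simps[OF p] X tangent[OF p])
qed

lemma eta_coord_field_differentiable:
  assumes "c \<in> charts_at A p"
  shows "(\<lambda>x. \<eta> (cinv c x) (coord_field c v (cinv c x))) differentiable (at (snd c p))"
  using assms eta
  by (intro smooth_on_differentiable_at[OF _ open_image]) (auto simp: one_form_def charts_at_iff)

text \<open>The last three terms are the covariant derivative of the associated metric with respect to the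
  Levi-Civita connection of \<open>g\<close>. They come from the Sasaki-like identity for \<open>\<nabla>\<phi>\<close> and from
  \<open>dir_deriv_eta\<close>.\<close>

lemma dir_deriv_associated_metric:
  assumes c: "c \<in> charts_at A p"
  defines "X \<equiv> \<lambda>u. coord_vector A c p u"
  shows "dir_deriv c (\<lambda>q. associated_metric \<phi> \<eta> g q (coord_field c u q) (coord_field c v q)) p (X z)
    = associated_metric \<phi> \<eta> g p (X (\<Gamma> c p z u)) (X v)
      + associated_metric \<phi> \<eta> g p (X u) (X (\<Gamma> c p z v))
      - \<eta> p (X u) * (g p (X z) (X v) + g p (X v) (\<phi> p (X z)))
      - \<eta> p (X v) * (g p (X z) (X u) + g p (X u) (\<phi> p (X z)))
      + 2 * \<eta> p (X z) * \<eta> p (X u) * \<eta> p (X v)"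
proof -
  have cA: "c \<in> A" "p \<in> fst c" using c by (simp_all add: charts_at_iff)
  note p = in_carrier[OF cA]
  have X: "X u \<in> T p" for u using coord_vector_in[OF c] by (simp add: X_def)
  note field = coord_field_is_field[OF cA(1)]
  note phi_field = phi_coord_field[OF cA(1)]
  note eta_diff = eta_coord_field_differentiable[OF c]
  have "dir_deriv c (\<lambda>q. g q (coord_field c u q) (\<phi> q (coord_field c v q))) p (X z)
    = g p (X (\<Gamma> c p z u)) (\<phi> p (X v)) + g p (X u) (\<phi> p (X (\<Gamma> c p z v)))
      - g p (X z) (X v) * \<eta> p (X u) - \<eta> p (X v) * g p (X u) (X z)
      + 2 * \<eta> p (X z) * \<eta> p (X v) * \<eta> p (X u)"
    unfolding X_def
    by (subst levi_civita_metric[OF lc c field field phi_field])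
       (simp add: nabla_coord_field[OF con c] nabla_phi[OF c field field] g_xi[OF p]
         coord_vector_in[OF c] g_right_simps[OF p] tangent[OF p])
  moreover have "dir_deriv c (\<lambda>q. \<eta> q (coord_field c u q) * \<eta> q (coord_field c v q)) p (X z)
    = \<eta> p (X u) * (\<eta> p (X (\<Gamma> c p z v)) - g p (X v) (\<phi> p (X z)))
      + (\<eta> p (X (\<Gamma> c p z u)) - g p (X u) (\<phi> p (X z))) * \<eta> p (X v)"
    unfolding dir_deriv_mult[OF eta_diff eta_diff c] unfolding X_def dir_deriv_eta[OF c] ..
  ultimately show ?thesis
    unfolding associated_metric_def
      dir_deriv_add[OF g_field_differentiable[OF c phi_field] differentiable_mult[OF eta_diff eta_diff]]
    by (simp add: algebra_simps g_sym[OF p X X, of u z])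
qed

text \<open>The difference \<open>D\<close> of the two connections is a symmetric tensor. Comparing the two expressions
  for the derivative of the associated metric \<open>g'\<close> determines
  \<open>g'(D(z,u),v) + g'(D(z,v),u)\<close>; as in the Koszul formula, the alternating sum over the cyclic
  permutations isolates \<open>2 g'(D(u,v),z)\<close>. It is a multiple of \<open>\<eta>(z) = g'(\<xi>,z)\<close>, so that
  nondegeneracy makes \<open>D(u,v)\<close> a multiple of \<open>\<xi>\<close>.\<close>

lemma associated_connection_difference:
  assumes lc': "levi_civita A (associated_metric \<phi> \<eta> g) \<Gamma>'" and c: "c \<in> charts_at A p"
  defines "X \<equiv> \<lambda>u. coord_vector A c p u"
  shows "X (\<Gamma>' c p u v) - X (\<Gamma> c p u v)
    = - ((g p (X u) (\<phi> p (X v)) - g p (\<phi> p (X u)) (\<phi> p (X v))) *\<^sub>R \<xi> p)"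
proof -
  have cA: "c \<in> A" "p \<in> fst c" using c by (simp_all add: charts_at_iff)
  note p = in_carrier[OF cA]
  have X: "X u \<in> T p" for u using coord_vector_in[OF c] by (simp add: X_def)
  note field = coord_field_is_field[OF cA(1)]
  have con': "connection A \<Gamma>'" using lc' by (simp add: levi_civita_def)
  let ?g' = "associated_metric \<phi> \<eta> g p"
  have sym: "?g' a b = ?g' b a" if "a \<in> T p" "b \<in> T p" for a b
    using that g_phi_sym[OF p, of a b] g_sym[OF p, of "\<phi> p a" b] by (simp add: associated_metric_def tangent[OF p])
  define D where "D u v = X (\<Gamma>' c p u v) - X (\<Gamma> c p u v)" for u v
  have D: "D u v \<in> T p" for u v by (simp add: D_def X tangent[OF p])
  have D_sym: "D u v = D v u" for u v
    unfolding D_def levi_civita_symmetric[OF lc c, of u v] levi_civita_symmetric[OF lc' c, of u v] ..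
  \<comment> \<open>The covariant derivative of the associated metric found in \<open>dir_deriv_associated_metric\<close>.\<close>
  define Q where "Q z u v = - \<eta> p (X u) * (g p (X z) (X v) + g p (X v) (\<phi> p (X z)))
      - \<eta> p (X v) * (g p (X z) (X u) + g p (X u) (\<phi> p (X z)))
      + 2 * \<eta> p (X z) * \<eta> p (X u) * \<eta> p (X v)" for z u v
  have Q: "?g' (D z u) (X v) + ?g' (D z v) (X u) = Q z u v" for z u v
  proof -
    have "dir_deriv c (\<lambda>q. associated_metric \<phi> \<eta> g q (coord_field c u q) (coord_field c v q)) p (X z)
        = ?g' (X (\<Gamma>' c p z u)) (X v) + ?g' (X u) (X (\<Gamma>' c p z v))"
      unfolding X_def
      by (subst levi_civita_metric[OF lc' c field field field]) (simp add: nabla_coord_field[OF con' c])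
    then have "?g' (X (\<Gamma>' c p z u)) (X v) - ?g' (X (\<Gamma> c p z u)) (X v)
        + (?g' (X u) (X (\<Gamma>' c p z v)) - ?g' (X u) (X (\<Gamma> c p z v))) = Q z u v"
      using dir_deriv_associated_metric[OF c, of u v z] unfolding X_def[symmetric] Q_def by simp
    moreover have "?g' (D z u) (X v) = ?g' (X (\<Gamma>' c p z u)) (X v) - ?g' (X (\<Gamma> c p z u)) (X v)" for u v
      unfolding D_def
      by (simp add: associated_metric_def eta_simps[OF p] g_left_simps[OF p] tangent[OF p] X algebra_simps)
    ultimately show ?thesis by (simp add: sym[OF X X, of u])
  qed
  have g_sym': "g p (X a) (X b) = g p (X b) (X a)" "g p (X a) (\<phi> p (X b)) = g p (X b) (\<phi> p (X a))" for a b
    using g_sym[OF p X X] g_sym[OF p X phi_in[OF p X]] g_phi_sym[OF p X X] by auto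
  let ?s = "g p (X u) (\<phi> p (X v)) - g p (\<phi> p (X u)) (\<phi> p (X v))"
  have "D u v + ?s *\<^sub>R \<xi> p = 0"
  proof (rule associated_metric_nondeg[OF p])
    fix w assume "w \<in> T p"
    then obtain z where z: "w = X z" using coord_vector_component[OF c] X_def by metis
    \<comment> \<open>The Koszul trick: the terms with \<open>D u z\<close> and \<open>D v z\<close> cancel by symmetry of \<open>D\<close>.\<close>
    have "2 * ?g' (D u v) (X z) = Q u v z + Q v u z - Q z u v"
      using Q[of u v z] Q[of v u z] Q[of z u v] D_sym by simp
    also have "\<dots> = - 2 * ?s * \<eta> p (X z)"
      unfolding Q_def g_phi_phi[OF p X X]
      by (simp add: g_sym'[of v u] g_sym'[of z u] g_sym'[of z v] algebra_simps)
    finally have "?g' (D u v) (X z) = - ?s * \<eta> p (X z)" by (simp add: algebra_simps)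
    moreover have "?g' (D u v + ?s *\<^sub>R \<xi> p) (X z) = ?g' (D u v) (X z) + ?s * \<eta> p (X z)"
      using D by (simp add: associated_metric_def phi_simps[OF p] eta_simps[OF p] g_left_simps[OF p]
        tangent[OF p] X eta_xi[OF p] g_xi_left[OF p] eta_phi[OF p] algebra_simps)
    ultimately show "?g' (D u v + ?s *\<^sub>R \<xi> p) w = 0" unfolding z by (simp add: algebra_simps)
  qed (simp add: D tangent[OF p])
  then show ?thesis unfolding D_def using eq_neg_iff_add_eq_0 by blast
qed

text \<open>On the kernel of \<open>\<eta>\<close> the endomorphism \<open>\<phi>\<close> is a complex structure, so \<open>v\<close> and \<open>\<phi>v\<close> are
  independent, and with \<open>\<xi>\<close> they form a basis of the 3-dimensional tangent space. If \<open>g(v,\<phi>v)\<close>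
  were zero, then \<open>v\<close> would be orthogonal to this basis.\<close>

lemma null_legendre_vector_b_nonzero:
  assumes c: "c \<in> charts_at A p" and v: "v \<in> T p" "v \<noteq> 0" "g p v v = 0" "\<eta> p v = 0"
  shows "g p v (\<phi> p v) \<noteq> 0"
proof
  assume b: "g p v (\<phi> p v) = 0"
  note p = chart_carrier[OF c]
  \<comment> \<open>Independence of \<open>v\<close>, \<open>\<phi>v\<close>, \<open>\<xi>\<close> is injectivity of \<open>G\<close>, read in the chart as a map of
    \<open>real^3\<close> to itself; it is then surjective.\<close>
  define G where "G y = (y $ 1) *\<^sub>R v + (y $ 2) *\<^sub>R \<phi> p v + (y $ 3) *\<^sub>R \<xi> p" for y :: "real^3"
  have G: "G y \<in> T p" for y by (simp add: G_def v tangent[OF p])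
  have zero: "0 \<in> T p" using tangent_scaleR[of v p 0] v(1) by simp
  have lin: "linear (\<lambda>y. G y c)"
    by (rule linearI) (simp_all add: G_def scaleR_fun_def algebra_simps)
  have "inj (\<lambda>y. G y c)"
    unfolding linear_injective_0[OF lin]
  proof (intro allI impI)
    fix y assume "G y c = 0"
    then have Gy: "G y = 0" using tangent_eqI[OF c G zero] by simp
    have "\<eta> p (G y) = y $ 3"
      using v by (simp add: G_def eta_simps[OF p] tangent[OF p] eta_phi[OF p] eta_xi[OF p])
    moreover have "\<eta> p (G y) = 0"
      using linear_on_scaleR[OF eta_linear[OF p] zero, of 0] Gy by simp
    ultimately have y3: "y $ 3 = 0" by simp
    \<comment> \<open>Combining \<open>G y = 0\<close> with \<open>\<phi>(G y) = 0\<close> eliminates \<open>\<phi>v\<close>.\<close>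
    have "\<phi> p (G y) = (y $ 1) *\<^sub>R \<phi> p v - (y $ 2) *\<^sub>R v"
      using v y3 by (simp add: G_def phi_simps[OF p] tangent[OF p] phi_phi[OF p])
    moreover have "\<phi> p (G y) = 0"
      using linear_on_scaleR[OF phi_linear[OF p] zero, of 0] Gy by simp
    ultimately have "(y $ 1) *\<^sub>R G y - (y $ 2) *\<^sub>R ((y $ 1) *\<^sub>R \<phi> p v - (y $ 2) *\<^sub>R v) = 0"
      using Gy by simp
    moreover have "(y $ 1) *\<^sub>R G y - (y $ 2) *\<^sub>R ((y $ 1) *\<^sub>R \<phi> p v - (y $ 2) *\<^sub>R v)
        = ((y $ 1)\<^sup>2 + (y $ 2)\<^sup>2) *\<^sub>R v"
      using y3 by (simp add: G_def algebra_simps power2_eq_square)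
    ultimately have "(y $ 1)\<^sup>2 + (y $ 2)\<^sup>2 = 0" using v(2) by simp
    then show "y = 0" using y3 by (simp add: vec_eq_iff forall_3 sum_power2_eq_zero_iff)
  qed
  then have surj: "surj (\<lambda>y. G y c)" using linear_injective_imp_surjective[OF lin] by simp
  have "v = 0"
  proof (rule g_nondeg[OF p v(1)])
    fix w assume w: "w \<in> T p"
    obtain y where "w c = G y c" using surj unfolding surj_def by blast
    then have "w = G y" by (rule tangent_eqI[OF c w G])
    then show "g p v w = 0"
      using v b by (simp add: G_def g_right_simps[OF p] tangent[OF p] g_xi[OF p])
  qed
  with v(2) show False by simp
qed

end


section \<open>Curves and affine changes of parameter\<close>

lemma has_derivative_imp_has_vector_derivative:
  assumes "(f has_derivative D) (at t within S)"
  shows "(f has_vector_derivative D 1) (at (t::real) within S)"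
proof -
  have "D u = u *\<^sub>R D 1" for u
    using linear_cmul[OF has_derivative_linear[OF assms], of u 1] by simp
  then have "D = (\<lambda>u. u *\<^sub>R D 1)" by (rule ext)
  then show ?thesis using assms unfolding has_vector_derivative_def by metis
qed

text \<open>At a limit point of a set of reals the derivative within the set is unique, so the
  arbitrarily chosen \<open>frechet_derivative\<close> is the given one.\<close>

lemma frechet_derivative_within_eqI:
  fixes t :: real
  assumes D: "(f has_derivative D) (at t within S)" and "at t within S \<noteq> bot"
  shows "frechet_derivative f (at t within S) = D"
proof
  fix u
  let ?F = "frechet_derivative f (at t within S)"
  have F: "(f has_derivative ?F) (at t within S)"
    using differentiableI[OF D] by (simp only: frechet_derivative_works)
  have "?F 1 = D 1"
    by (rule vector_derivative_unique_within[OF assms(2)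
          has_derivative_imp_has_vector_derivative[OF F] has_derivative_imp_has_vector_derivative[OF D]])
  then show "?F u = D u"
    using linear_cmul[OF has_derivative_linear[OF D], of u 1]
      linear_cmul[OF has_derivative_linear[OF F], of u 1] by simp
qed

lemma affine_preimage_nontrivial:
  assumes "a > 0" "at (t0 + a * s) within S \<noteq> bot"
  shows "at s within {s. t0 + a * s \<in> S} \<noteq> (bot :: real filter)"
proof -
  have lim: "(t0 + a * s) islimpt S" using assms(2) by (simp add: trivial_limit_within)
  have "s islimpt {s. t0 + a * s \<in> S}"
    unfolding islimpt_approachable
  proof (intro allI impI)
    fix e :: real assume "e > 0"
    then have "a * e > 0" using assms(1) by simp
    then obtain t where t: "t \<in> S" "t \<noteq> t0 + a * s" "dist t (t0 + a * s) < a * e"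
      using lim unfolding islimpt_approachable by blast
    have "\<bar>(t - t0) / a - s\<bar> = \<bar>t - (t0 + a * s)\<bar> / a"
    proof -
      have "(t - t0) / a - s = (t - (t0 + a * s)) / a" using assms(1) by (simp add: field_simps)
      then show ?thesis using assms(1) by (simp add: abs_divide)
    qed
    then have "dist ((t - t0) / a) s < e"
      using t(3) assms(1) by (simp add: dist_real_def field_simps)
    moreover have "(t - t0) / a \<noteq> s" using t(2) assms(1) by (auto simp: field_simps)
    moreover have "(t - t0) / a \<in> {s. t0 + a * s \<in> S}" using t(1) assms(1) by simp
    ultimately show "\<exists>y\<in>{s. t0 + a * s \<in> S}. y \<noteq> s \<and> dist y s < e" by blast
  qed
  then show ?thesis by (simp add: trivial_limit_within)
qed

lemma affine_has_derivative:
  assumes "(f has_derivative D) (at (t0 + a * s) within S)"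
  shows "((\<lambda>s. f (t0 + a * s)) has_derivative (\<lambda>u. D (a * u))) (at (s::real) within {s. t0 + a * s \<in> S})"
proof -
  let ?S = "{s. t0 + a * s \<in> S}"
  have "((\<lambda>s. t0 + a * s) has_derivative (\<lambda>u. a * u)) (at s within ?S)"
    by (auto intro!: derivative_eq_intros)
  moreover have "(f has_derivative D) (at (t0 + a * s) within (\<lambda>s. t0 + a * s) ` ?S)"
    by (rule has_derivative_subset[OF assms]) auto
  ultimately show ?thesis using diff_chain_within by (fastforce simp: o_def)
qed

lemma affine_has_vector_derivative:
  assumes "(f has_vector_derivative D) (at (t0 + a * s) within S)"
  shows "((\<lambda>s. f (t0 + a * s)) has_vector_derivative a *\<^sub>R D) (at (s::real) within {s. t0 + a * s \<in> S})"
  using affine_has_derivative[OF assms[unfolded has_vector_derivative_def]]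
  by (simp add: has_vector_derivative_def mult.commute)

text \<open>The statement for \<open>k + 1\<close> in the direction \<open>v\<close> reduces to that for \<open>k\<close> in the direction
  \<open>a * v\<close>. Nontriviality of the filters, true for relatively open subsets of nondegenerate
  intervals, ensures that the derivatives are unique, including the one-sided ones at end points.\<close>

lemma Ck_on_affine:
  fixes f :: "real \<Rightarrow> 'b::real_normed_vector"
  assumes a: "a > 0" and S: "\<And>t. t \<in> S \<Longrightarrow> at t within S \<noteq> bot" and "Ck_on k f S"
  shows "Ck_on k (\<lambda>s. f (t0 + a * s)) {s. t0 + a * s \<in> S}"
  using assms(3)
proof (induction k arbitrary: f)
  case 0
  have "continuous_on {s. t0 + a * s \<in> S} (\<lambda>s. f (t0 + a * s))"
    by (rule continuous_on_compose2[of S f]) (use 0 in \<open>auto intro!: continuous_intros\<close>)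
  then show ?case by simp
next
  case (Suc k)
  let ?S = "{s. t0 + a * s \<in> S}" and ?f = "\<lambda>s. f (t0 + a * s)"
  have D: "(?f has_derivative (\<lambda>u. frechet_derivative f (at (t0 + a * s) within S) (a * u))) (at s within ?S)"
    if "s \<in> ?S" for s
  proof (rule affine_has_derivative)
    have "f differentiable (at (t0 + a * s) within S)" using Suc.prems that by simp
    then show "(f has_derivative frechet_derivative f (at (t0 + a * s) within S)) (at (t0 + a * s) within S)"
      by (simp only: frechet_derivative_works)
  qed
  have "Ck_on k (\<lambda>s. frechet_derivative ?f (at s within ?S) v) ?S" for v
  proof (rule Ck_on_cong)
    show "Ck_on k (\<lambda>s. frechet_derivative f (at (t0 + a * s) within S) (a * v)) ?S"
      using Suc.IH[of "\<lambda>t. frechet_derivative f (at t within S) (a * v)"] Suc.prems by simp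
    show "frechet_derivative f (at (t0 + a * s) within S) (a * v) = frechet_derivative ?f (at s within ?S) v"
      if s: "s \<in> ?S" for s
    proof -
      have "at s within ?S \<noteq> bot" using s by (intro affine_preimage_nontrivial[OF a] S) simp
      from frechet_derivative_within_eqI[OF D[OF s] this] show ?thesis by simp
    qed
  qed
  moreover have "\<forall>s\<in>?S. ?f differentiable (at s within ?S)"
    using D by (intro ballI differentiableI)
  ultimately show ?case by simp
qed

locale atlas_curve = atlas A for A :: "'a::{t2_space,second_countable_topology} chart set" +
  fixes I :: "real set" and C :: "real \<Rightarrow> 'a"
  assumes curve: "smooth_curve A I C"
begin

abbreviation V :: "real \<Rightarrow> 'a tangent" where "V \<equiv> velocity A I C"

lemma within_nontrivial:
  assumes "t \<in> I" shows "at t within I \<noteq> bot"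
proof -
  have "connected I" "\<nexists>x. I = {x}" using curve by (auto simp: smooth_curve_def is_interval_connected)
  then have "t islimpt I" using connected_imp_perfect assms by blast
  then show ?thesis by (simp add: trivial_limit_within)
qed

text \<open>Charts cover only pieces of the curve. Since \<open>C\<close> is continuous on \<open>I\<close>, derivatives within such a
  piece are derivatives within \<open>I\<close>.\<close>

lemma within_open:
  assumes "t \<in> I" "open U" "C t \<in> U"
  shows "at t within {s \<in> I. C s \<in> U} = at t within I"
proof -
  have "continuous_on I C" using curve by (simp add: smooth_curve_def)
  then obtain B where B: "open B" "B \<inter> I = C -` U \<inter> I"
    using assms(2) unfolding continuous_on_open_invariant by blast
  show ?thesis by (rule at_within_nhd[of _ B]) (use B assms in auto)
qed

lemma transform_open:
  assumes "(f has_vector_derivative D) (at t within I)" "t \<in> I" "open U" "C t \<in> U"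
    and eq: "\<And>s. s \<in> I \<Longrightarrow> C s \<in> U \<Longrightarrow> h s = f s"
  shows "(h has_vector_derivative D) (at t within I)"
proof -
  let ?S = "{s \<in> I. C s \<in> U}"
  have "(f has_vector_derivative D) (at t within ?S)"
    using assms(1) by (simp only: within_open[OF assms(2-4)])
  then have "(h has_vector_derivative D) (at t within ?S)"
    unfolding has_vector_derivative_def
    by (rule has_derivative_transform[of t ?S h f, rotated 2]) (use assms in auto)
  then show ?thesis by (simp only: within_open[OF assms(2-4)])
qed

lemma velocity_has_derivatives:
  assumes t: "t \<in> I" and c: "c \<in> charts_at A (C t)"
  shows "((\<lambda>s. snd c (C s)) has_vector_derivative V t c) (at t within I)"
    and "\<exists>D. ((\<lambda>s. V s c) has_vector_derivative D) (at t within I)"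
proof -
  let ?S = "{s \<in> I. C s \<in> fst c}" and ?x = "\<lambda>s. snd c (C s)"
  have cA: "c \<in> A" "C t \<in> fst c" using c by (simp_all add: charts_at_iff)
  have smooth: "smooth_on ?x ?S" using curve cA by (simp add: smooth_curve_def)
  have at: "at s within ?S = at s within I" if "s \<in> ?S" for s
    by (rule within_open) (use that open_fst[OF cA(1)] in auto)
  have "Ck_on (Suc (Suc 0)) ?x ?S" using smooth by (simp only: smooth_on_def)
  then have Ck: "\<forall>s\<in>?S. ?x differentiable (at s within ?S)"
     "\<forall>v. \<forall>s\<in>?S. (\<lambda>r. frechet_derivative ?x (at r within ?S) v) differentiable (at s within ?S)"
    by simp_all
  have x: "(?x has_vector_derivative V s c) (at s within I)"
    and V_eq: "V s c = frechet_derivative ?x (at s within ?S) 1" if s: "s \<in> ?S" for s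
  proof -
    have "(?x has_derivative frechet_derivative ?x (at s within ?S)) (at s within ?S)"
      using bspec[OF Ck(1) s] by (simp only: frechet_derivative_works)
    then have *: "(?x has_vector_derivative frechet_derivative ?x (at s within ?S) 1) (at s within I)"
      unfolding at[OF s, symmetric] by (rule has_derivative_imp_has_vector_derivative)
    then show "V s c = frechet_derivative ?x (at s within ?S) 1"
      using s cA within_nontrivial[of s]
      by (simp add: velocity_def charts_at_iff vector_derivative_within)
    with * show "(?x has_vector_derivative V s c) (at s within I)" by simp
  qed
  show "(?x has_vector_derivative V t c) (at t within I)" using x t cA by simp
  obtain D where "((\<lambda>r. frechet_derivative ?x (at r within ?S) 1) has_derivative D) (at t within ?S)"
    using Ck(2) t cA unfolding differentiable_def by blast
  then have "((\<lambda>r. frechet_derivative ?x (at r within ?S) 1) has_vector_derivative D 1) (at t within I)"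
    unfolding within_open[OF t open_fst[OF cA(1)] cA(2), symmetric]
    by (rule has_derivative_imp_has_vector_derivative)
  then have "((\<lambda>s. V s c) has_vector_derivative D 1) (at t within I)"
    by (rule transform_open[OF _ t open_fst[OF cA(1)] cA(2)]) (simp add: V_eq)
  then show "\<exists>D. ((\<lambda>s. V s c) has_vector_derivative D) (at t within I)" by blast
qed

text \<open>Chain rule for \<open>transition c c' \<circ> (snd c \<circ> C)\<close>.\<close>

lemma velocity_in:
  assumes t: "t \<in> I" shows "V t \<in> T (C t)"
proof -
  obtain c where c: "c \<in> charts_at A (C t)"
    using curve t by (auto simp: smooth_curve_def manifold_carrier_def charts_at_iff)
  have cA: "c \<in> A" "C t \<in> fst c" using c by (simp_all add: charts_at_iff)
  show ?thesis
  proof (rule tangent_spaceI[OF c])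
    fix c' assume c': "c' \<in> charts_at A (C t)"
    have "(transition c c' \<circ> (\<lambda>s. snd c (C s)) has_vector_derivative transition_deriv c c' (C t) (V t c))
        (at t within I)"
      by (rule vector_derivative_diff_chain_within[OF velocity_has_derivatives(1)[OF t c]])
         (rule has_derivative_at_withinI[OF transition_has_derivative[OF c c']])
    then have "((\<lambda>s. snd c' (C s)) has_vector_derivative transition_deriv c c' (C t) (V t c)) (at t within I)"
      by (rule transform_open[OF _ t open_fst[OF cA(1)] cA(2)]) (simp add: transition_snd cA)
    then show "V t c' = transition_deriv c c' (C t) (V t c)"
      by (rule vector_derivative_unique_within[OF within_nontrivial[OF t] velocity_has_derivatives(1)[OF t c']])
  qed (simp add: velocity_def)
qed

lemma acceleration:
  assumes "t \<in> I" "c \<in> charts_at A (C t)"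
  shows "((\<lambda>s. V s c) has_vector_derivative vector_derivative (\<lambda>s. V s c) (at t within I)) (at t within I)"
  using velocity_has_derivatives(2)[OF assms] vector_derivative_within[OF within_nontrivial[OF assms(1)]] by metis

context
  fixes a t0 :: real and J :: "real set" and C' :: "real \<Rightarrow> 'a"
  assumes a: "a > 0" and J: "J = {s. t0 + a * s \<in> I}" and C'_eq: "\<forall>s\<in>J. C' s = C (t0 + a * s)"
begin

lemmas C' = bspec[OF C'_eq]

lemma smooth_curve_affine: "smooth_curve A J C'"
  unfolding smooth_curve_def
proof (intro conjI ballI)
  have I: "is_interval I" "C ` I \<subseteq> manifold_carrier A" "continuous_on I C"
    using curve by (simp_all add: smooth_curve_def)
  show "is_interval J"
    unfolding is_interval_1
  proof (intro ballI allI impI)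
    fix x y z assume "x \<in> J" "y \<in> J" and z: "x \<le> z \<and> z \<le> y"
    then have "t0 + a * x \<in> I" "t0 + a * y \<in> I" unfolding J by simp_all
    moreover have "t0 + a * x \<le> t0 + a * z" "t0 + a * z \<le> t0 + a * y" using z a by simp_all
    ultimately have "t0 + a * z \<in> I" using I(1) mem_is_interval_1_I by blast
    then show "z \<in> J" unfolding J by simp
  qed
  obtain u v where "u \<in> I" "v \<in> I" "u < v" using curve unfolding smooth_curve_def by blast
  then have "(u - t0) / a \<in> J" "(v - t0) / a \<in> J" "(u - t0) / a < (v - t0) / a"
    using a by (simp_all add: J divide_strict_right_mono)
  then show "\<exists>s\<in>J. \<exists>t\<in>J. s < t" by blast
  show "C' ` J \<subseteq> manifold_carrier A" using I(2) C' J by auto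
  have "continuous_on J (\<lambda>s. C (t0 + a * s))"
    by (rule continuous_on_compose2[OF I(3)]) (auto intro!: continuous_intros simp: J)
  then show "continuous_on J C'" by (rule continuous_on_eq) (simp add: C')
next
  fix c assume c: "c \<in> A"
  let ?S = "{t \<in> I. C t \<in> fst c}"
  have S: "{s \<in> J. C' s \<in> fst c} = {s. t0 + a * s \<in> ?S}" using C' J by auto
  have nontrivial: "at t within ?S \<noteq> bot" if "t \<in> ?S" for t
    using within_open[OF _ open_fst[OF c]] within_nontrivial that by auto
  have "Ck_on k (\<lambda>s. snd c (C (t0 + a * s))) {s. t0 + a * s \<in> ?S}" for k
  proof (rule Ck_on_affine[OF a nontrivial])
    show "Ck_on k (\<lambda>t. snd c (C t)) ?S"
      using curve c unfolding smooth_curve_def smooth_on_def by blast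
  qed
  then have "smooth_on (\<lambda>s. snd c (C (t0 + a * s))) {s \<in> J. C' s \<in> fst c}"
    unfolding smooth_on_def S by blast
  then show "smooth_on (\<lambda>s. snd c (C' s)) {s \<in> J. C' s \<in> fst c}"
    by (rule smooth_on_cong[rotated]) (simp add: C')
qed

interpretation reparam: atlas_curve A J C'
  by unfold_locales (rule smooth_curve_affine)

lemma velocity_affine:
  assumes s: "s \<in> J" shows "velocity A J C' s = a *\<^sub>R velocity A I C (t0 + a * s)"
proof
  fix c
  have t: "t0 + a * s \<in> I" using s J by simp
  show "velocity A J C' s c = (a *\<^sub>R velocity A I C (t0 + a * s)) c"
  proof (cases "c \<in> charts_at A (C' s)")
    case True
    then have "c \<in> charts_at A (C (t0 + a * s))" using C'[OF s] by simp
    from affine_has_vector_derivative[OF velocity_has_derivatives(1)[OF t this]]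
    have "((\<lambda>s. snd c (C (t0 + a * s))) has_vector_derivative a *\<^sub>R V (t0 + a * s) c) (at s within J)"
      unfolding J .
    then have "((\<lambda>s. snd c (C' s)) has_vector_derivative a *\<^sub>R V (t0 + a * s) c) (at s within J)"
      unfolding has_vector_derivative_def by (rule has_derivative_transform[OF s, rotated]) (simp add: C')
    from vector_derivative_unique_within[OF reparam.within_nontrivial[OF s] reparam.velocity_has_derivatives(1)[OF s True] this]
    show ?thesis by (simp add: scaleR_fun_def)
  next
    case False
    then show ?thesis using C'[OF s] by (simp add: velocity_def scaleR_fun_def)
  qed
qed

text \<open>Both parts of the acceleration pick up \<open>a\<^sup>2\<close>: the second derivative by the chain rule, the term
  with the connection coefficients because it is bilinear and the velocity is scaled by \<open>a\<close>.\<close>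

lemma nabla_along_velocity_affine:
  assumes con: "connection A \<Gamma>" and s: "s \<in> J"
  shows "nabla_along A \<Gamma> J C' (velocity A J C') s
    = a\<^sup>2 *\<^sub>R nabla_along A \<Gamma> I C (velocity A I C) (t0 + a * s)"
proof
  fix c
  have t: "t0 + a * s \<in> I" using s J by simp
  show "nabla_along A \<Gamma> J C' (velocity A J C') s c
    = (a\<^sup>2 *\<^sub>R nabla_along A \<Gamma> I C (velocity A I C) (t0 + a * s)) c"
  proof (cases "c \<in> charts_at A (C' s)")
    case True
    then have c: "c \<in> charts_at A (C (t0 + a * s))" using C'[OF s] by simp
    let ?D = "vector_derivative (\<lambda>t. V t c) (at (t0 + a * s) within I)"
    from affine_has_vector_derivative[OF acceleration[OF t c]]
    have "((\<lambda>s. V (t0 + a * s) c) has_vector_derivative a *\<^sub>R ?D) (at s within J)"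
      unfolding J .
    then have "((\<lambda>s. a *\<^sub>R V (t0 + a * s) c) has_vector_derivative a *\<^sub>R a *\<^sub>R ?D) (at s within J)"
      by (rule bounded_linear.has_vector_derivative[OF bounded_linear_scaleR_right])
    then have "((\<lambda>s. velocity A J C' s c) has_vector_derivative a *\<^sub>R a *\<^sub>R ?D) (at s within J)"
      unfolding has_vector_derivative_def
      by (rule has_derivative_transform[OF s, rotated]) (simp add: velocity_affine scaleR_fun_def)
    then have "vector_derivative (\<lambda>s. velocity A J C' s c) (at s within J) = a *\<^sub>R a *\<^sub>R ?D"
      by (rule vector_derivative_within[OF reparam.within_nontrivial[OF s]])
    moreover have "bilinear (\<Gamma> c (C (t0 + a * s)))"
      using con c by (simp add: connection_def charts_at_iff)
    ultimately show ?thesis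
      using True c C'[OF s]
      by (simp add: nabla_along_def scaleR_fun_def velocity_affine[OF s] bilinear_lmul bilinear_rmul
          power2_eq_square algebra_simps)
  next
    case False
    then show ?thesis using C'[OF s] by (simp add: nabla_along_def scaleR_fun_def)
  qed
qed

end

lemma arc_length_constant_speed:
  assumes r: "\<And>t. t \<in> I \<Longrightarrow> sqrt \<bar>g (C t) (V t) (V t)\<bar> = r" and t0: "t0 \<in> I" and t: "t \<in> I"
  shows "arc_length A g I C t0 t = r * (t - t0)"
proof -
  have I: "{x..y} \<subseteq> I" if "x \<in> I" "y \<in> I" for x y
  proof -
    have "is_interval I" using curve by (simp add: smooth_curve_def)
    then show ?thesis using mem_is_interval_1_I that by (meson atLeastAtMost_iff subsetI)
  qed
  have "integral {x..y} (\<lambda>t. sqrt \<bar>g (C t) (V t) (V t)\<bar>) = r * (y - x)" if "x \<in> I" "y \<in> I" "x \<le> y" for x y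
  proof -
    have "integral {x..y} (\<lambda>t. sqrt \<bar>g (C t) (V t) (V t)\<bar>) = integral {x..y} (\<lambda>t. r)"
      by (rule integral_cong) (use I that r in blast)
    also have "\<dots> = r * (y - x)" using that by simp
    finally show ?thesis .
  qed
  note int = this
  show ?thesis
  proof (cases "t0 \<le> t")
    case True
    then show ?thesis unfolding arc_length_def Let_def by (simp add: int[OF t0 t])
  next
    case False
    then show ?thesis
      unfolding arc_length_def Let_def by (simp add: int[OF t t0] right_diff_distrib)
  qed
qed

end


section \<open>Legendre null curves\<close>

context sasaki_manifold
begin

text \<open>Along the curve \<open>0 = d/dt \<eta>(V) = (\<nabla>\<^sub>V\<eta>)(V) + \<eta>(\<nabla>\<^sub>VV)\<close>, and \<open>(\<nabla>\<^sub>V\<eta>)(V) = -g(V,\<phi>V)\<close>. The argument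
  of \<open>\<eta>\<close> is rebuilt from its components in one chart, which is a tangent vector by construction.\<close>

lemma legendre_acceleration_eta:
  assumes "smooth_curve A I C" and legendre: "\<And>s. s \<in> I \<Longrightarrow> \<eta> (C s) (velocity A I C s) = 0"
    and t: "t \<in> I" and c: "c \<in> charts_at A (C t)"
  shows "\<eta> (C t) (coord_vector A c (C t) (nabla_along A \<Gamma> I C (velocity A I C) t c))
    = curve_b A \<phi> g I C t"
proof -
  interpret atlas_curve A I C by unfold_locales (rule assms(1))
  let ?S = "{s \<in> I. C s \<in> fst c}" and ?x = "\<lambda>s. snd c (C s)" and ?p = "C t"
  let ?a = "vector_derivative (\<lambda>s. V s c) (at t within I)"
  have cA: "c \<in> A" "?p \<in> fst c" using c by (simp_all add: charts_at_iff)
  note p = in_carrier[OF cA]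
  have tS: "t \<in> ?S" using t cA by simp
  have at: "at t within ?S = at t within I" using within_open[OF t open_fst[OF cA(1)] cA(2)] .
  have cs: "c \<in> charts_at A (C s)" if "s \<in> ?S" for s using that cA by (simp add: charts_at_iff)
  let ?L = "\<lambda>s w. \<eta> (C s) (coord_field c w (C s))"
  let ?d = "\<lambda>w. dir_deriv c (\<lambda>q. \<eta> q (coord_field c w q)) ?p (V t)"
  have "((\<lambda>s. ?L s (V s c)) has_derivative (\<lambda>u. u *\<^sub>R ?d (V t c) + ?L t (u *\<^sub>R ?a))) (at t within ?S)"
  proof (rule has_derivative_linear_family[where L = ?L and Y = "\<lambda>s. V s c" and L' = "\<lambda>u w. u *\<^sub>R ?d w", OF _ tS])
    fix s assume s: "s \<in> ?S"
    note eta_simps' = linear_on_add[OF eta_linear[OF chart_carrier[OF cs[OF s]]]]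
      linear_on_scaleR[OF eta_linear[OF chart_carrier[OF cs[OF s]]]]
    show "linear (?L s)"
      by (rule linearI) (simp_all only: linear_add[OF linear_coord_vector[OF cs[OF s]]]
         linear_cmul[OF linear_coord_vector[OF cs[OF s]]] eta_simps' coord_vector_in[OF cs[OF s]])
  next
    fix w
    let ?h = "\<lambda>x. \<eta> (cinv c x) (coord_field c w (cinv c x))"
    have "(?h \<circ> ?x has_vector_derivative ?d w) (at t within I)"
      unfolding dir_deriv_def
      by (rule vector_derivative_diff_chain_within[OF velocity_has_derivatives(1)[OF t c]])
         (rule has_derivative_at_withinI[OF has_derivative_frechet_at[OF eta_coord_field_differentiable[OF c]]])
    then have "((\<lambda>s. ?L s w) has_vector_derivative ?d w) (at t within I)"
      by (rule transform_open[OF _ t open_fst[OF cA(1)] cA(2)]) (simp add: cinv_snd cA)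
    then show "((\<lambda>s. ?L s w) has_derivative (\<lambda>u. u *\<^sub>R ?d w)) (at t within ?S)"
      by (simp only: has_vector_derivative_def at)
  next
    show "((\<lambda>s. V s c) has_derivative (\<lambda>u. u *\<^sub>R ?a)) (at t within ?S)"
      using acceleration[OF t c] by (simp only: has_vector_derivative_def at)
  qed
  from has_derivative_imp_has_vector_derivative[OF this]
  have "((\<lambda>s. ?L s (V s c)) has_vector_derivative ?d (V t c) + ?L t ?a) (at t within I)"
    by (simp add: at)
  then have "((\<lambda>s. 0) has_vector_derivative ?d (V t c) + ?L t ?a) (at t within I)"
    by (rule transform_open[OF _ t open_fst[OF cA(1)] cA(2)])
       (use cs coord_vector_component velocity_in legendre in \<open>simp add: charts_at_iff cA\<close>)
  then have "?d (V t c) + ?L t ?a = 0"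
    by (rule vector_derivative_unique_within[OF within_nontrivial[OF t] _ has_vector_derivative_const])
  moreover have "V t = coord_vector A c ?p (V t c)"
    using coord_vector_component[OF c velocity_in[OF t]] by simp
  moreover have "?d (V t c) = \<eta> ?p (coord_vector A c ?p (\<Gamma> c ?p (V t c) (V t c))) - g ?p (V t) (\<phi> ?p (V t))"
    using dir_deriv_eta[OF c, of "V t c" "V t c"] coord_vector_component[OF c velocity_in[OF t]] by simp
  ultimately show ?thesis
    using c by (simp add: nabla_along_def curve_b_def linear_add[OF linear_coord_vector[OF c]]
      eta_simps[OF p] coord_vector_in[OF c])
qed

lemma nabla_along_associated:
  assumes lc': "levi_civita A (associated_metric \<phi> \<eta> g) \<Gamma>'"
    and curve: "smooth_curve A I C" and t: "t \<in> I"
  defines "v \<equiv> velocity A I C t"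
  shows "nabla_along A \<Gamma>' I C (velocity A I C) t = nabla_along A \<Gamma> I C (velocity A I C) t
    - (g (C t) v (\<phi> (C t) v) - g (C t) (\<phi> (C t) v) (\<phi> (C t) v)) *\<^sub>R \<xi> (C t)"
proof
  interpret atlas_curve A I C by unfold_locales (rule curve)
  let ?s = "g (C t) v (\<phi> (C t) v) - g (C t) (\<phi> (C t) v) (\<phi> (C t) v)"
  fix c
  show "nabla_along A \<Gamma>' I C V t c = (nabla_along A \<Gamma> I C V t - ?s *\<^sub>R \<xi> (C t)) c"
  proof (cases "c \<in> charts_at A (C t)")
    case True
    have v: "coord_vector A c (C t) (v c) = v"
      using coord_vector_component[OF True velocity_in[OF t]] by (simp add: v_def)
    from fun_cong[OF associated_connection_difference[OF lc' True, of "v c" "v c"], of c]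
    have "\<Gamma>' c (C t) (v c) (v c) - \<Gamma> c (C t) (v c) (v c) = - (?s *\<^sub>R \<xi> (C t) c)"
      using coord_vector_self[OF True] by (simp add: v scaleR_fun_def)
    then show ?thesis
      using True by (simp add: nabla_along_def scaleR_fun_def v_def algebra_simps)
  next
    case False
    have "\<xi> (C t) c = 0"
    proof -
      have "C t \<in> manifold_carrier A" using curve t by (auto simp: smooth_curve_def)
      from xi_in[OF this] False show ?thesis unfolding tangent_space_iff by blast
    qed
    with False show ?thesis by (simp add: nabla_along_def scaleR_fun_def)
  qed
qed

end

theorem theorem5p1:
  fixes A :: "'a::{t2_space,second_countable_topology} chart set"
    and \<phi> :: "'a \<Rightarrow> 'a tangent \<Rightarrow> 'a tangent"
    and \<xi> :: "'a \<Rightarrow> 'a tangent"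
    and \<eta> :: "'a \<Rightarrow> 'a tangent \<Rightarrow> real"
    and g g' :: "'a \<Rightarrow> 'a tangent \<Rightarrow> 'a tangent \<Rightarrow> real"
    and \<Gamma> \<Gamma>' :: "'a conn"
    and I :: "real set" and C :: "real \<Rightarrow> 'a"
    and \<epsilon> \<epsilon>1 :: real
    and N W :: "real \<Rightarrow> 'a tangent"
    and k1 k2 b :: "real \<Rightarrow> real"
    and t0 :: real and J :: "real set" and C' :: "real \<Rightarrow> 'a"
  assumes "sasaki_like A \<phi> \<xi> \<eta> g \<Gamma>"
    and g'_def: "g' = associated_metric \<phi> \<eta> g"
    and "levi_civita A g' \<Gamma>'"
    and "smooth_curve A I C" and "null_curve A g I C" and "legendre_curve A \<xi> g I C"
    and "\<epsilon> \<in> {1, -1}" and "\<epsilon>1 \<in> {1, -1}"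
    and W_def: "W = frame_W A \<phi> \<xi> g \<epsilon> \<epsilon>1 I C"
    and "is_frame_N A g I C W N"
    and "frame_curvatures A \<Gamma> I C N W k1 k2"
    and "k1 constant_on I" and "k2 constant_on I"
    and b_def: "b = curve_b A \<phi> g I C"
    and "t0 \<in> I"
    and J_def: "J = arc_length A g' I C t0 ` I"
    and C'_def: "C' = arc_length_param A g' I C t0"
  shows "inj_on (arc_length A g' I C t0) I \<and> smooth_curve A J C' \<and>
    ((\<forall>t\<in>I. b t > 0) \<or> (\<forall>t\<in>I. b t < 0)) \<and>
    ((\<forall>t\<in>I. b t > 0) \<longrightarrow> unit_spacelike_curve A g' J C') \<and>
    ((\<forall>t\<in>I. b t < 0) \<longrightarrow> unit_timelike_curve A g' J C') \<and>
    legendre_curve A \<xi> g' J C' \<and>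
    geodesic_curve A \<Gamma>' J C'"
proof -
  interpret sasaki_manifold A \<phi> \<xi> \<eta> g \<Gamma> by unfold_locales (rule assms(1))
  interpret atlas_curve A I C by unfold_locales (rule assms(4))
  have carrier: "C t \<in> manifold_carrier A" if "t \<in> I" for t
    using assms(4) that by (auto simp: smooth_curve_def)
  have null: "g (C t) (V t) (V t) = 0" "V t \<noteq> 0" if "t \<in> I" for t
    using assms(5) that by (auto simp: null_curve_def)
  have eta_V: "\<eta> (C t) (V t) = 0" if "t \<in> I" for t
    using assms(6) that g_xi[OF carrier velocity_in, of t] by (auto simp: legendre_curve_def)
  have b_eq: "b t = g (C t) (V t) (\<phi> (C t) (V t))" for t by (simp add: b_def curve_b_def)
  define \<sigma> where "\<sigma> = \<epsilon>1 * \<epsilon>"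
  have nabla_V: "nabla_along A \<Gamma> I C V t = k1 t *\<^sub>R W t" if "t \<in> I" for t
    using assms(11) that by (simp add: frame_curvatures_def)
  have W_eq: "W t = \<sigma> *\<^sub>R (\<xi> (C t) + (vector_derivative b (at t within I) / (2 * (b t)\<^sup>2)) *\<^sub>R V t)" for t
    by (simp add: W_def frame_W_def Let_def b_def \<sigma>_def)

  have b_k1: "b t = k1 t * \<sigma>" if t: "t \<in> I" for t
  proof -
    obtain c where c: "c \<in> charts_at A (C t)"
      using carrier[OF t] by (auto simp: manifold_carrier_def charts_at_iff)
    note p = carrier[OF t]
    have W: "W t \<in> T (C t)" and eta_W: "\<eta> (C t) (W t) = \<sigma>"
      unfolding W_eq using velocity_in[OF t] eta_V[OF t]
      by (simp_all add: eta_simps[OF p] tangent[OF p] eta_xi[OF p])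
    have "b t = \<eta> (C t) (coord_vector A c (C t) (nabla_along A \<Gamma> I C V t c))"
      using legendre_acceleration_eta[OF assms(4) eta_V t c] by (simp add: b_def)
    also have "\<dots> = \<eta> (C t) (k1 t *\<^sub>R W t)"
      unfolding nabla_V[OF t] by (subst coord_vector_component[OF c]) (simp_all add: W tangent[OF p])
    also have "\<dots> = k1 t * \<sigma>" using W by (simp add: eta_simps[OF p] eta_W)
    finally show ?thesis .
  qed
  obtain K where K: "\<And>t. t \<in> I \<Longrightarrow> b t = K"
    using assms(12) b_k1 unfolding constant_on_def by metis
  have K_nonzero: "K \<noteq> 0"
  proof -
    obtain c where "c \<in> charts_at A (C t0)"
      using carrier[OF \<open>t0 \<in> I\<close>] by (auto simp: manifold_carrier_def charts_at_iff)
    from null_legendre_vector_b_nonzero[OF this velocity_in[OF \<open>t0 \<in> I\<close>] null(2,1) eta_V] show ?thesis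
      using K \<open>t0 \<in> I\<close> b_eq by metis
  qed

  have geodesic: "nabla_along A \<Gamma>' I C V t = 0" if t: "t \<in> I" for t
  proof -
    note p = carrier[OF t]
    \<comment> \<open>Since \<open>b\<close> is constant, the component of \<open>W\<close> along the velocity vanishes.\<close>
    have "((\<lambda>t. K) has_vector_derivative 0) (at t within I)" by (rule has_vector_derivative_const)
    then have "(b has_vector_derivative 0) (at t within I)"
      unfolding has_vector_derivative_def by (rule has_derivative_transform[OF t, rotated]) (rule K)
    then have "vector_derivative b (at t within I) = 0"
      by (rule vector_derivative_within[OF within_nontrivial[OF t]])
    then have "nabla_along A \<Gamma> I C V t = b t *\<^sub>R \<xi> (C t)"
      by (simp add: nabla_V[OF t] W_eq b_k1[OF t])
    then show ?thesis
      using nabla_along_associated[OF assms(3)[unfolded g'_def] assms(4) t]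
        g_phi_phi[OF p velocity_in[OF t] velocity_in[OF t]]
      by (simp add: null[OF t] eta_V[OF t] flip: b_eq)
  qed

  have speed: "g' (C t) (V t) (V t) = K" if "t \<in> I" for t
    using K[OF that] eta_V[OF that] by (simp add: g'_def associated_metric_def b_eq)
  define r where "r = sqrt \<bar>K\<bar>"
  have r: "r > 0" "r\<^sup>2 = \<bar>K\<bar>" using K_nonzero by (simp_all add: r_def)
  have arc: "arc_length A g' I C t0 t = r * (t - t0)" if "t \<in> I" for t
    by (rule arc_length_constant_speed[OF _ \<open>t0 \<in> I\<close> that]) (simp add: speed r_def)
  have inj: "inj_on (arc_length A g' I C t0) I"
    using r(1) by (auto simp: inj_on_def arc)
  \<comment> \<open>The arc length parameter \<open>s = r (t - t0)\<close> is inverted by \<open>t = t0 + a s\<close>.\<close>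
  define a where "a = 1 / r"
  have a: "a > 0" "a\<^sup>2 * \<bar>K\<bar> = 1" using r by (simp_all add: a_def power_divide flip: r(2))
  have J: "J = {s. t0 + a * s \<in> I}"
  proof (intro set_eqI iffI)
    fix s assume "s \<in> {s. t0 + a * s \<in> I}"
    moreover from this have "arc_length A g' I C t0 (t0 + a * s) = s" using r(1) by (simp add: arc a_def)
    ultimately show "s \<in> J" unfolding J_def by (metis imageI mem_Collect_eq)
  qed (use r(1) in \<open>auto simp: J_def arc a_def\<close>)
  have C': "C' s = C (t0 + a * s)" if "s \<in> J" for s
  proof -
    have t: "t0 + a * s \<in> I" using that J by simp
    have "arc_length A g' I C t0 (t0 + a * s) = s" using t r(1) by (simp add: arc a_def)
    then show ?thesis using inv_into_f_f[OF inj t] by (simp add: C'_def arc_length_param_def)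
  qed
  have "\<forall>s\<in>J. C' s = C (t0 + a * s)" using C' by blast
  note reparam = a(1) J this
  note V' = velocity_affine[OF reparam]

  have unit: "g' (C' s) (velocity A J C' s) (velocity A J C' s) = a\<^sup>2 * K"
    and legendre: "g' (C' s) (velocity A J C' s) (\<xi> (C' s)) = 0" if s: "s \<in> J" for s
  proof -
    have t: "t0 + a * s \<in> I" using s J by simp
    note p = carrier[OF t] and v = velocity_in[OF t]
    note simps = phi_simps[OF p] eta_simps[OF p] g_left_simps[OF p] g_right_simps[OF p] tangent[OF p] v
      eta_V[OF t] phi_xi[OF p] g_zero_right[OF p]
    show "g' (C' s) (velocity A J C' s) (velocity A J C' s) = a\<^sup>2 * K"
      using K[OF t] unfolding V'[OF s] C'[OF s] g'_def associated_metric_def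
      by (simp add: simps power2_eq_square b_eq)
    show "g' (C' s) (velocity A J C' s) (\<xi> (C' s)) = 0"
      unfolding V'[OF s] C'[OF s] g'_def associated_metric_def by (simp add: simps)
  qed
  have con': "connection A \<Gamma>'" using assms(3) by (simp add: levi_civita_def)

  have "(\<forall>t\<in>I. b t > 0) \<or> (\<forall>t\<in>I. b t < 0)" using K K_nonzero by (metis linorder_neqE_linordered_idom)
  moreover have "unit_spacelike_curve A g' J C'" if "\<forall>t\<in>I. b t > 0"
    using that K \<open>t0 \<in> I\<close> a(2) by (auto simp: unit_spacelike_curve_def unit)
  moreover have "unit_timelike_curve A g' J C'" if "\<forall>t\<in>I. b t < 0"
    using that K \<open>t0 \<in> I\<close> a(2) by (auto simp: unit_timelike_curve_def unit)
  moreover have "legendre_curve A \<xi> g' J C'" by (simp add: legendre_curve_def legendre)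
  moreover have "geodesic_curve A \<Gamma>' J C'"
    unfolding geodesic_curve_def
    using nabla_along_velocity_affine[OF reparam con'] geodesic J by simp
  ultimately show ?thesis using inj smooth_curve_affine[OF reparam] by blast
qed

end
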